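(* Let $a$ be an integer such that $a^2-2$ and $a^2+2$ are both prime, and let $E_a$ be the elliptic curve $y^2 = x^3 + 2a^2x^2 + (a^4-4)x$ over $\mathbb{Q}$. Then the rank of $E_a(\mathbb{Q})$ equals $1$. *)

theory Defs
  imports
    "HOL-Algebra.FiniteProduct"
    "HOL-Computational_Algebra.Primes"
    "HOL-Library.Extended_Nat"
begin

text \<open>
  Curves are given by Weierstrass equations \<open>y\<^sup>2 = x\<^sup>3 + A x\<^sup>2 + B x + C\<close> over a field
  of characteristic 0; \<open>Infinity\<close> is the point at infinity of the projective closure.
\<close>

datatype 'a ec_point = Infinity | Affine 'a 'a

definition ec_points :: "'a::field_char_0 \<Rightarrow> 'a \<Rightarrow> 'a \<Rightarrow> 'a ec_point set" where
  "ec_points A B C =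
     insert Infinity {Affine x y | x y. y^2 = x^3 + A * x^2 + B * x + C}"

text \<open>
  Chord-and-tangent addition: \<open>l\<close> is the slope of the chord through the two points, or of the
  tangent line if they coincide. Two points of the curve with the same abscissa are equal or
  opposite, so the tangent formula is only ever used for equal points with \<open>y1 \<noteq> 0\<close>.
  The coefficient \<open>C\<close> does not occur in the formulas.
\<close>

fun ec_add :: "'a::field_char_0 \<Rightarrow> 'a \<Rightarrow> 'a ec_point \<Rightarrow> 'a ec_point \<Rightarrow> 'a ec_point" where
  "ec_add A B Infinity Q = Q"
| "ec_add A B P Infinity = P"
| "ec_add A B (Affine x1 y1) (Affine x2 y2) =
     (if x1 = x2 \<and> y1 = - y2 then Infinity
      else let l = (if x1 = x2 then (3 * x1^2 + 2 * A * x1 + B) / (2 * y1)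
                    else (y2 - y1) / (x2 - x1));
               x3 = l^2 - A - x1 - x2
           in Affine x3 (l * (x1 - x3) - y1))"

definition ec_group :: "'a::field_char_0 \<Rightarrow> 'a \<Rightarrow> 'a \<Rightarrow> 'a ec_point monoid" where
  "ec_group A B C =
     \<lparr>carrier = ec_points A B C, monoid.mult = ec_add A B, one = Infinity\<rparr>"

text \<open>
  The usual discriminant \<open>\<Delta>\<close> of the Weierstrass equation, i.e. 16 times the discriminant of the
  cubic; the equation defines an elliptic curve iff it is nonzero.
\<close>

definition ec_discriminant :: "'a::field_char_0 \<Rightarrow> 'a \<Rightarrow> 'a \<Rightarrow> 'a" where
  "ec_discriminant A B C =
     16 * (A^2 * B^2 - 4 * B^3 - 4 * A^3 * C - 27 * C^2 + 18 * A * B * C)"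

text \<open>
  The (torsion-free) rank of an abelian group, written multiplicatively: the supremum of the
  cardinalities of its finite \<open>\<int>\<close>-linearly independent subsets, \<open>\<infinity>\<close> if these are unbounded.
  For a finitely generated group isomorphic to \<open>\<int>\<^sup>r \<times> T\<close> with \<open>T\<close> finite, this is \<open>r\<close>.
\<close>

definition int_independent :: "('a, 'b) monoid_scheme \<Rightarrow> 'a set \<Rightarrow> bool" where
  "int_independent G S \<longleftrightarrow>
     finite S \<and> S \<subseteq> carrier G \<and>
     (\<forall>c :: 'a \<Rightarrow> int.
        finprod G (\<lambda>x. x [^]\<^bsub>G\<^esub> c x) S = \<one>\<^bsub>G\<^esub> \<longrightarrow> (\<forall>x\<in>S. c x = 0))"

definition abelian_rank :: "('a, 'b) monoid_scheme \<Rightarrow> enat" where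
  "abelian_rank G = (SUP S \<in> {S. int_independent G S}. enat (card S))"

text \<open>The curve \<open>E\<^sub>a\<close> is the case \<open>A = 2 a\<^sup>2\<close>, \<open>B = a\<^sup>4 - 4\<close>, \<open>C = 0\<close> over \<open>\<rat>\<close>.\<close>

definition E_group :: "int \<Rightarrow> rat ec_point monoid" where
  "E_group a = ec_group (2 * (of_int a)^2) ((of_int a)^4 - 4) 0"

lemma E_is_elliptic:
  assumes "prime (a^2 - 2 :: int)"
  shows "ec_discriminant (2 * (of_int a)^2) ((of_int a)^4 - 4) 0 \<noteq> (0 :: rat)"
proof -
  have "a^2 - 2 \<noteq> 0" using assms by (metis not_prime_0)
  moreover have "a^2 + 2 \<noteq> 0" using zero_le_power2[of a] by linarith
  ultimately have "(a^2 - 2) * (a^2 + 2) \<noteq> 0" by simp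
  then have "a^4 - 4 \<noteq> 0" by (simp add: algebra_simps flip: power_add)
  then have "rat_of_int (a^4 - 4) \<noteq> 0" by (simp only: of_int_eq_0_iff) simp
  then have nz: "(rat_of_int a)^4 - 4 \<noteq> 0" by simp
  have "ec_discriminant (2 * (rat_of_int a)^2) ((of_int a)^4 - 4) 0
        = 256 * ((rat_of_int a)^4 - 4)^2"
    unfolding ec_discriminant_def
    by (simp add: power2_eq_square power3_eq_cube power4_eq_xxxx algebra_simps)
  with nz show ?thesis by simp
qed

end

theory Submission
  imports Defs "HOL-Computational_Algebra.Nth_Powers"
begin

text \<open>
  With \<open>p = a\<^sup>2 - 2\<close> and \<open>q = a\<^sup>2 + 2\<close> the curve is \<open>y\<^sup>2 = x (x + p) (x + q)\<close>. It embeds into the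
  intersection of quadrics \<open>4 s\<^sup>2 + c\<^sup>2 = 1 = q s\<^sup>2 + d\<^sup>2\<close>, on which the addition formulas of the Jacobi
  functions sn, cn, dn have no exceptions; so associativity there is a polynomial identity, and the
  embedding carries it over to the chord-and-tangent law.

  The descent also takes place on the quadrics. The points with 2-adically even \<open>s\<close> form a subgroup
  of index 2, and each of them is, up to signs of \<open>c\<close> and \<open>d\<close> (that is, up to 2-torsion), the double of a
  rational point: for \<open>(s, c, d) = (S/Z, C/Z, D/Z)\<close> in lowest terms, coprimality makes \<open>(Z \<plusminus> C) / 2\<close>, \<open>(Z \<plusminus> D) / 2\<close>, \<open>(C \<plusminus> D) / 2\<close> squares up to the
  factors \<open>p\<close>, \<open>q\<close> and a sign, and the wrong sign would represent \<open>q n\<^sup>2\<close> as a sum of two squares although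
  \<open>q\<close> is 3 modulo 4. The image of \<open>P\<^sub>0 = (-a\<^sup>2, 2 a)\<close> is not even. As doubling raises the denominator
  of \<open>s\<close> to the fourth power up to a constant, repeated halving stays in a finite set, so every point has a
  nonzero multiple in the subgroup generated by \<open>P\<^sub>0\<close>. Finally \<open>P\<^sub>0\<close> has infinite order: odd multiples are
  not even, and there is no rational 4-torsion.
\<close>

section \<open>The Jacobi intersection of quadrics as a group\<close>

definition jac_points :: "'a::linordered_field \<Rightarrow> 'a \<Rightarrow> ('a \<times> 'a \<times> 'a) set" where
  "jac_points \<alpha> \<beta> = {(s, c, d). \<alpha> * s^2 + c^2 = 1 \<and> \<beta> * s^2 + d^2 = 1}"

text \<open>The addition theorem of \<open>sn\<close>, \<open>cn\<close>, \<open>dn\<close> with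
  modulus \<open>k^2 = \<beta> / \<alpha>\<close>, written for \<open>s = sn / sqrt \<alpha>\<close>
  so that no root has to be taken in the field.\<close>

fun jac_add :: "'a::linordered_field \<Rightarrow> 'a \<Rightarrow> 'a \<times> 'a \<times> 'a \<Rightarrow> 'a \<times> 'a \<times> 'a \<Rightarrow> 'a \<times> 'a \<times> 'a" where
  "jac_add \<alpha> \<beta> (s1, c1, d1) (s2, c2, d2) =
     (let N = 1 - \<alpha> * \<beta> * s1 * s1 * s2 * s2
      in ((s1 * c2 * d2 + s2 * c1 * d1) / N,
          (c1 * c2 - \<alpha> * s1 * s2 * d1 * d2) / N,
          (d1 * d2 - \<beta> * s1 * s2 * c1 * c2) / N))"

definition jac_group :: "'a::linordered_field \<Rightarrow> 'a \<Rightarrow> ('a \<times> 'a \<times> 'a) monoid" where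
  "jac_group \<alpha> \<beta> = \<lparr>carrier = jac_points \<alpha> \<beta>, monoid.mult = jac_add \<alpha> \<beta>, one = (0, 1, 1)\<rparr>"

locale jacobi =
  fixes \<alpha> \<beta> :: "'a::linordered_field"
  assumes alpha_nonneg: "0 \<le> \<alpha>" and alpha_less_beta: "\<alpha> < \<beta>"
begin

text \<open>A point has \<open>\<beta> * s^2 \<le> 1\<close>, hence
  \<open>\<alpha> * s^2 < 1\<close>, so the product subtracted from 1 stays below 1. The order of
  the field thus removes all exceptional pairs from the addition.\<close>

lemma denominator_pos:
  assumes "(s1, c1, d1) \<in> jac_points \<alpha> \<beta>" "(s2, c2, d2) \<in> jac_points \<alpha> \<beta>"
  shows "0 < 1 - \<alpha> * \<beta> * s1 * s1 * s2 * s2"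
proof -
  have 1: "\<beta> * s1^2 \<le> 1" "\<beta> * s2^2 \<le> 1"
    using assms by (auto simp: jac_points_def) (metis le_add_same_cancel1 zero_le_power2)+
  have "\<alpha> * s1^2 < 1"
  proof (cases "s1 = 0")
    case False
    then have "\<alpha> * s1^2 < \<beta> * s1^2" using alpha_less_beta by simp
    with 1 show ?thesis by simp
  qed simp
  moreover have "\<alpha> * s1^2 * (\<beta> * s2^2) \<le> \<alpha> * s1^2 * 1"
    using 1 alpha_nonneg by (intro mult_left_mono) auto
  ultimately have "\<alpha> * s1^2 * (\<beta> * s2^2) < 1" by simp
  then show ?thesis by (simp add: power2_eq_square mult_ac)
qed

lemma jac_add_closed:
  assumes "P \<in> jac_points \<alpha> \<beta>" "Q \<in> jac_points \<alpha> \<beta>"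
  shows "jac_add \<alpha> \<beta> P Q \<in> jac_points \<alpha> \<beta>"
proof -
  obtain s1 c1 d1 s2 c2 d2 where PQ: "P = (s1, c1, d1)" "Q = (s2, c2, d2)"
    by (metis prod_cases3)
  define N where "N = 1 - \<alpha> * \<beta> * s1 * s1 * s2 * s2"
  define X where "X = s1 * c2 * d2 + s2 * c1 * d1"
  define Y where "Y = c1 * c2 - \<alpha> * s1 * s2 * d1 * d2"
  define Z where "Z = d1 * d2 - \<beta> * s1 * s2 * c1 * c2"
  have eqs: "\<alpha> * s1^2 + c1^2 = 1" "\<beta> * s1^2 + d1^2 = 1" "\<alpha> * s2^2 + c2^2 = 1" "\<beta> * s2^2 + d2^2 = 1"
    using assms PQ by (auto simp: jac_points_def)
  have "N \<noteq> 0" using denominator_pos assms PQ unfolding N_def by fastforce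
  have "\<alpha> * X^2 + Y^2 = N^2" "\<beta> * X^2 + Z^2 = N^2"
    unfolding X_def Y_def Z_def N_def using eqs by algebra+
  then have "\<alpha> * (X/N)^2 + (Y/N)^2 = 1" "\<beta> * (X/N)^2 + (Z/N)^2 = 1"
    using \<open>N \<noteq> 0\<close> by (simp_all add: field_simps power_divide)
  then show ?thesis
    unfolding PQ by (simp add: jac_points_def Let_def N_def X_def Y_def Z_def)
qed

text \<open>Associativity, coordinate by coordinate, with denominators cleared. Replacing every
  square of a \<open>c\<close> or \<open>d\<close> by its polynomial in \<open>s\<close> brings both
  sides to the same normal form.\<close>

lemma jac_assoc_identities:
  assumes C: "c1*c1 = 1 - \<alpha>*s1*s1" "c2*c2 = 1 - \<alpha>*s2*s2" "c3*c3 = 1 - \<alpha>*s3*s3"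
    and D: "d1*d1 = 1 - \<beta>*s1*s1" "d2*d2 = 1 - \<beta>*s2*s2" "d3*d3 = 1 - \<beta>*s3*s3"
    and defs: "X = s1*c2*d2 + s2*c1*d1" "Y = c1*c2 - \<alpha>*s1*s2*d1*d2"
      "Z = d1*d2 - \<beta>*s1*s2*c1*c2" "N = 1 - \<alpha>*\<beta>*s1*s1*s2*s2"
      "X' = s2*c3*d3 + s3*c2*d2" "Y' = c2*c3 - \<alpha>*s2*s3*d2*d3"
      "Z' = d2*d3 - \<beta>*s2*s3*c2*c3" "N' = 1 - \<alpha>*\<beta>*s2*s2*s3*s3"
  shows "(X*N*c3*d3 + s3*Y*Z) * (N'*N' - \<alpha>*\<beta>*s1*s1*X'*X') =
      (s1*Y'*Z' + X'*N'*c1*d1) * (N*N - \<alpha>*\<beta>*X*X*s3*s3)" (is ?thesis1)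
    and "(Y*c3*N - \<alpha>*X*s3*Z*d3) * (N'*N' - \<alpha>*\<beta>*s1*s1*X'*X') =
      (c1*Y'*N' - \<alpha>*s1*X'*d1*Z') * (N*N - \<alpha>*\<beta>*X*X*s3*s3)" (is ?thesis2)
    and "(Z*d3*N - \<beta>*X*s3*Y*c3) * (N'*N' - \<alpha>*\<beta>*s1*s1*X'*X') =
      (d1*Z'*N' - \<beta>*s1*X'*c1*Y') * (N*N - \<alpha>*\<beta>*X*X*s3*s3)" (is ?thesis3)
proof -
  \<comment> \<open>In the sorted products a square may stand in front of a further factor
    \<open>z\<close>; these variants of the curve equations reach it there.\<close>
  have R: "c1*(c1*z) = (1 - \<alpha>*s1*s1)*z" "c2*(c2*z) = (1 - \<alpha>*s2*s2)*z" "c3*(c3*z) = (1 - \<alpha>*s3*s3)*z"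
     "d1*(d1*z) = (1 - \<beta>*s1*s1)*z" "d2*(d2*z) = (1 - \<beta>*s2*s2)*z" "d3*(d3*z) = (1 - \<beta>*s3*s3)*z" for z
    using C D by (simp_all flip: mult.assoc)
  show ?thesis1 ?thesis2 ?thesis3 unfolding defs
    by (simp_all add: algebra_simps C D R)
qed

lemma jac_add_assoc:
  assumes "P \<in> jac_points \<alpha> \<beta>" "Q \<in> jac_points \<alpha> \<beta>" "R \<in> jac_points \<alpha> \<beta>"
  shows "jac_add \<alpha> \<beta> (jac_add \<alpha> \<beta> P Q) R = jac_add \<alpha> \<beta> P (jac_add \<alpha> \<beta> Q R)"
proof -
  obtain s1 c1 d1 s2 c2 d2 s3 c3 d3
    where PQR: "P = (s1, c1, d1)" "Q = (s2, c2, d2)" "R = (s3, c3, d3)"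
    by (metis prod_cases3)
  define X where "X = s1*c2*d2 + s2*c1*d1"
  define Y where "Y = c1*c2 - \<alpha>*s1*s2*d1*d2"
  define Z where "Z = d1*d2 - \<beta>*s1*s2*c1*c2"
  define N where "N = 1 - \<alpha>*\<beta>*s1*s1*s2*s2"
  define X' where "X' = s2*c3*d3 + s3*c2*d2"
  define Y' where "Y' = c2*c3 - \<alpha>*s2*s3*d2*d3"
  define Z' where "Z' = d2*d3 - \<beta>*s2*s3*c2*c3"
  define N' where "N' = 1 - \<alpha>*\<beta>*s2*s2*s3*s3"
  have add: "jac_add \<alpha> \<beta> P Q = (X/N, Y/N, Z/N)" "jac_add \<alpha> \<beta> Q R = (X'/N', Y'/N', Z'/N')"
    unfolding PQR by (simp_all add: Let_def X_def Y_def Z_def N_def X'_def Y'_def Z'_def N'_def)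
  \<comment> \<open>\<open>M\<close> and \<open>M'\<close> are the denominators of the two outer
    additions multiplied by \<open>N * N\<close> and \<open>N' * N'\<close>.\<close>
  define M where "M = N*N - \<alpha>*\<beta>*X*X*s3*s3"
  define M' where "M' = N'*N' - \<alpha>*\<beta>*s1*s1*X'*X'"
  have N: "N \<noteq> 0" "N' \<noteq> 0"
    using denominator_pos[of s1 c1 d1 s2 c2 d2] denominator_pos[of s2 c2 d2 s3 c3 d3] assms
    by (auto simp: PQR N_def N'_def)
  have "0 < 1 - \<alpha>*\<beta>*(X/N)*(X/N)*s3*s3" "0 < 1 - \<alpha>*\<beta>*s1*s1*(X'/N')*(X'/N')"
    using denominator_pos[of "X/N" "Y/N" "Z/N" s3 c3 d3] denominator_pos[of s1 c1 d1 "X'/N'" "Y'/N'" "Z'/N'"]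
      jac_add_closed[OF assms(1,2)] jac_add_closed[OF assms(2,3)] assms add
    by (auto simp: PQR)
  moreover have M: "1 - \<alpha>*\<beta>*(X/N)*(X/N)*s3*s3 = M/(N*N)" "1 - \<alpha>*\<beta>*s1*s1*(X'/N')*(X'/N') = M'/(N'*N')"
    using N by (simp_all add: M_def M'_def diff_divide_distrib)
  ultimately have MM: "M \<noteq> 0" "M' \<noteq> 0" by auto
  have "c1*c1 = 1 - \<alpha>*s1*s1" "c2*c2 = 1 - \<alpha>*s2*s2" "c3*c3 = 1 - \<alpha>*s3*s3"
       "d1*d1 = 1 - \<beta>*s1*s1" "d2*d2 = 1 - \<beta>*s2*s2" "d3*d3 = 1 - \<beta>*s3*s3"
    using assms by (auto simp: PQR jac_points_def power2_eq_square algebra_simps)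
  note I = jac_assoc_identities[OF this X_def Y_def Z_def N_def X'_def Y'_def Z'_def N'_def,
      folded M_def M'_def]
  have "jac_add \<alpha> \<beta> (jac_add \<alpha> \<beta> P Q) R =
     ((X*N*c3*d3 + s3*Y*Z)/M, (Y*c3*N - \<alpha>*X*s3*Z*d3)/M, (Z*d3*N - \<beta>*X*s3*Y*c3)/M)"
    unfolding add unfolding PQR jac_add.simps Let_def M using N MM by (simp add: field_simps)
  moreover have "jac_add \<alpha> \<beta> P (jac_add \<alpha> \<beta> Q R) =
     ((s1*Y'*Z' + X'*N'*c1*d1)/M', (c1*Y'*N' - \<alpha>*s1*X'*d1*Z')/M', (d1*Z'*N' - \<beta>*s1*X'*c1*Y')/M')"
    unfolding add unfolding PQR jac_add.simps Let_def M using N MM by (simp add: field_simps)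
  ultimately show ?thesis
    using I MM by (simp add: frac_eq_eq)
qed

lemma jac_add_neg:
  assumes "(s, c, d) \<in> jac_points \<alpha> \<beta>"
  shows "jac_add \<alpha> \<beta> (-s, c, d) (s, c, d) = (0, 1, 1)"
proof -
  have eqs: "\<alpha> * s^2 + c^2 = 1" "\<beta> * s^2 + d^2 = 1" using assms by (auto simp: jac_points_def)
  have "c*c + \<alpha>*s*s*d*d = 1 - \<alpha>*\<beta>*s*s*s*s" "d*d + \<beta>*s*s*c*c = 1 - \<alpha>*\<beta>*s*s*s*s"
    using eqs by algebra+
  moreover have "0 < 1 - \<alpha>*\<beta>*s*s*s*s" using denominator_pos[OF assms assms] .
  ultimately show ?thesis by (simp add: Let_def)
qed

lemma jac_comm_group: "comm_group (jac_group \<alpha> \<beta>)"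
proof (rule comm_groupI)
  fix P Q assume "P \<in> carrier (jac_group \<alpha> \<beta>)" "Q \<in> carrier (jac_group \<alpha> \<beta>)"
  then show "P \<otimes>\<^bsub>jac_group \<alpha> \<beta>\<^esub> Q \<in> carrier (jac_group \<alpha> \<beta>)"
    by (simp add: jac_group_def jac_add_closed)
next
  fix P Q R assume "P \<in> carrier (jac_group \<alpha> \<beta>)" "Q \<in> carrier (jac_group \<alpha> \<beta>)" "R \<in> carrier (jac_group \<alpha> \<beta>)"
  then show "P \<otimes>\<^bsub>jac_group \<alpha> \<beta>\<^esub> Q \<otimes>\<^bsub>jac_group \<alpha> \<beta>\<^esub> R
      = P \<otimes>\<^bsub>jac_group \<alpha> \<beta>\<^esub> (Q \<otimes>\<^bsub>jac_group \<alpha> \<beta>\<^esub> R)"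
    by (simp add: jac_group_def jac_add_assoc)
next
  fix P Q assume "P \<in> carrier (jac_group \<alpha> \<beta>)" "Q \<in> carrier (jac_group \<alpha> \<beta>)"
  show "P \<otimes>\<^bsub>jac_group \<alpha> \<beta>\<^esub> Q = Q \<otimes>\<^bsub>jac_group \<alpha> \<beta>\<^esub> P"
    by (cases P; cases Q) (simp add: jac_group_def Let_def algebra_simps)
next
  fix P assume P: "P \<in> carrier (jac_group \<alpha> \<beta>)"
  then show "\<one>\<^bsub>jac_group \<alpha> \<beta>\<^esub> \<otimes>\<^bsub>jac_group \<alpha> \<beta>\<^esub> P = P"
    by (cases P) (simp add: jac_group_def Let_def)
  obtain s c d where scd: "P = (s, c, d)" by (metis prod_cases3)
  have "jac_add \<alpha> \<beta> (-s, c, d) P = (0, 1, 1)"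
    using P jac_add_neg by (simp add: scd jac_group_def)
  moreover have "(-s, c, d) \<in> carrier (jac_group \<alpha> \<beta>)"
    using P by (simp add: scd jac_group_def jac_points_def)
  ultimately show "\<exists>Q\<in>carrier (jac_group \<alpha> \<beta>). Q \<otimes>\<^bsub>jac_group \<alpha> \<beta>\<^esub> P = \<one>\<^bsub>jac_group \<alpha> \<beta>\<^esub>"
    by (auto simp: jac_group_def)
qed (simp add: jac_group_def jac_points_def)

lemma inv_jac:
  assumes "(s, c, d) \<in> carrier (jac_group \<alpha> \<beta>)"
  shows "inv\<^bsub>jac_group \<alpha> \<beta>\<^esub> (s, c, d) = (-s, c, d)"
proof -
  interpret comm_group "jac_group \<alpha> \<beta>" by (rule jac_comm_group)
  show ?thesis
    using jac_add_neg[of s c d] assms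
    by (intro inv_equality) (auto simp: jac_group_def jac_points_def)
qed

end

section \<open>Embedding the split cubic\<close>

text \<open>Vieta's relations for
  \<open>x^3 + A*x^2 + B*x - (l*x + n)^2 = (x - x1)*(x - x2)*(x - x3)\<close>. They hold for chord
  and tangent alike, so later arguments need no case distinction on the slope.\<close>

lemma ec_add_line:
  fixes x1 :: "'a::field_char_0"
  assumes "Affine x1 y1 \<in> ec_points A B 0" "Affine x2 y2 \<in> ec_points A B 0" "\<not> (x1 = x2 \<and> y1 = - y2)"
  obtains l n x3 where "ec_add A B (Affine x1 y1) (Affine x2 y2) = Affine x3 (- (l * x3 + n))"
    "y1 = l * x1 + n" "y2 = l * x2 + n"
    "A = l^2 - x1 - x2 - x3" "B = x1*x2 + x1*x3 + x2*x3 + 2*l*n" "x1*x2*x3 = n^2"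
proof -
  define l where "l = (if x1 = x2 then (3 * x1^2 + 2 * A * x1 + B) / (2 * y1) else (y2 - y1) / (x2 - x1))"
  define x3 where "x3 = l^2 - A - x1 - x2"
  define n where "n = y1 - l * x1"
  have curve: "y1^2 = x1^3 + A * x1^2 + B * x1" "y2^2 = x2^3 + A * x2^2 + B * x2"
    using assms by (auto simp: ec_points_def)
  have y1: "y1 = l * x1 + n" by (simp add: n_def)
  have A: "A = l^2 - x1 - x2 - x3" by (simp add: x3_def)
  have "y2 = l * x2 + n \<and> B = x1*x2 + x1*x3 + x2*x3 + 2*l*n"
  proof (cases "x1 = x2")
    case True
    with curve have "y1^2 = y2^2" by simp
    with assms(3) True have "y1 = y2" by (metis power2_eq_iff)
    with True assms(3) have "y1 \<noteq> 0" by auto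
    then have "2 * l * y1 = 3 * x1^2 + 2 * A * x1 + B" using True by (simp add: l_def)
    then have "B = x1*x2 + x1*x3 + x2*x3 + 2*l*n"
      using A y1 True by algebra
    then show ?thesis using y1 True \<open>y1 = y2\<close> by simp
  next
    case False
    then have "l * (x2 - x1) = y2 - y1" by (simp add: l_def)
    then have y2: "y2 = l * x2 + n" by (simp add: n_def algebra_simps)
    \<comment> \<open>Subtracting the two curve equations yields the relation for \<open>B\<close>
      times \<open>x1 - x2\<close>, which can be cancelled on a chord.\<close>
    have "(x1 - x2) * (B - (x1*x2 + x1*x3 + x2*x3 + 2*l*n)) = 0"
      using curve y1 y2 A by algebra
    with False y2 show ?thesis by simp
  qed
  moreover from this have "x1*x2*x3 = n^2"
    using curve(1) y1 A by algebra
  moreover have "ec_add A B (Affine x1 y1) (Affine x2 y2) = Affine x3 (- (l * x3 + n))"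
  proof -
    have "ec_add A B (Affine x1 y1) (Affine x2 y2) = Affine x3 (l * (x1 - x3) - y1)"
      using assms(3) unfolding ec_add.simps l_def[symmetric] Let_def x3_def[symmetric] by simp
    also have "l * (x1 - x3) - y1 = - (l * x3 + n)"
      by (simp add: n_def algebra_simps)
    finally show ?thesis .
  qed
  ultimately show ?thesis using that A y1 by blast
qed

lemma ec_add_closed:
  fixes A :: "'a::field_char_0"
  assumes "P \<in> ec_points A B 0" "Q \<in> ec_points A B 0"
  shows "ec_add A B P Q \<in> ec_points A B 0"
proof (cases P)
  case P: (Affine x1 y1)
  show ?thesis
  proof (cases Q)
    case Q: (Affine x2 y2)
    show ?thesis
    proof (cases "x1 = x2 \<and> y1 = - y2")
      case True
      then show ?thesis by (simp add: P Q ec_points_def)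
    next
      case False
      obtain l n x3 where *: "ec_add A B (Affine x1 y1) (Affine x2 y2) = Affine x3 (- (l * x3 + n))"
        "A = l^2 - x1 - x2 - x3" "B = x1*x2 + x1*x3 + x2*x3 + 2*l*n" "x1*x2*x3 = n^2"
        using ec_add_line[of x1 y1 A B x2 y2] assms False P Q by metis
      have "(- (l * x3 + n))^2 = x3^3 + A * x3^2 + B * x3"
        using *(2-4) by algebra
      then show ?thesis by (simp only: P Q *(1)) (simp add: ec_points_def)
    qed
  qed (use assms in \<open>simp add: P\<close>)
qed (use assms in simp)

text \<open>
  In the next three lemmas \<open>x1\<close>, \<open>x2\<close>, \<open>x3\<close> are the abscissae in which the line \<open>y = l x + n\<close> meets
  \<open>y\<^sup>2 = x (x + p) (x + q)\<close>. They are the relations \<open>cn u cn v = cn w + \<alpha> sn u sn v dn w\<close>,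
  \<open>dn u dn v = dn w + \<beta> sn u sn v cn w\<close> and \<open>sn w dn u = cn u sn v + sn u cn v dn w\<close> for \<open>w = u + v\<close>,
  which are linear in the coordinates of \<open>w\<close>.
\<close>
lemma ec_add_jacobi_cn:
  fixes p q :: "'a::field_char_0"
  assumes "p + q = l^2 - x1 - x2 - x3" "p * q = x1*x2 + x1*x3 + x2*x3 + 2*l*n" "x1*x2*x3 = n^2"
  shows "(x1^2 + 2*p*x1 + p*q) * (x2^2 + 2*p*x2 + p*q) * (x3^2 + 2*q*x3 + p*q) =
    (x3^2 + 2*p*x3 + p*q) * (x1^2 + 2*q*x1 + p*q) * (x2^2 + 2*q*x2 + p*q)
      + 4*(q - p) * (l*x1 + n) * (l*x2 + n) * (x3^2 - p*q)"
  using assms by algebra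

lemma ec_add_jacobi_dn:
  fixes p q :: "'a::field_char_0"
  assumes "p + q = l^2 - x1 - x2 - x3" "p * q = x1*x2 + x1*x3 + x2*x3 + 2*l*n" "x1*x2*x3 = n^2"
  shows "(x1^2 - p*q) * (x2^2 - p*q) * (x3^2 + 2*q*x3 + p*q) =
    (x3^2 - p*q) * (x1^2 + 2*q*x1 + p*q) * (x2^2 + 2*q*x2 + p*q)
      + 4*q * (l*x1 + n) * (l*x2 + n) * (x3^2 + 2*p*x3 + p*q)"
proof - \<comment> \<open>moving the root \<open>-p\<close> to the origin exchanges the roles of \<open>cn\<close> and \<open>dn\<close>\<close>
  have "-p + (q - p) = l^2 - (x1+p) - (x2+p) - (x3+p)"
    using assms(1) by (simp add: algebra_simps)
  moreover have "-p * (q - p) = (x1+p)*(x2+p) + (x1+p)*(x3+p) + (x2+p)*(x3+p) + 2*l*(n - l*p)"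
    using assms(1,2) by algebra
  moreover have "(x1+p)*(x2+p)*(x3+p) = (n - l*p)^2"
    using assms by algebra
  ultimately show ?thesis
    using ec_add_jacobi_cn[of "-p" "q - p" l "x1+p" "x2+p" "x3+p" "n - l*p"]
    by (simp add: algebra_simps power2_eq_square)
qed

lemma ec_add_jacobi_sn:
  fixes p q :: "'a::field_char_0"
  assumes "p + q = l^2 - x1 - x2 - x3" "p * q = x1*x2 + x1*x3 + x2*x3 + 2*l*n" "x1*x2*x3 = n^2"
  shows "-(l*x3 + n) * (x1^2 - p*q) * (x2^2 + 2*q*x2 + p*q) =
    (x1^2 + 2*p*x1 + p*q) * (l*x2 + n) * (x3^2 + 2*q*x3 + p*q)
      + (l*x1 + n) * (x2^2 + 2*p*x2 + p*q) * (x3^2 - p*q)"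
  using assms by algebra

section \<open>The embedding into the quadrics\<close>

text \<open>The 2-torsion abscissae \<open>0\<close>, \<open>-p\<close>, \<open>-q\<close> go to
  \<open>(0, 1, -1)\<close>, \<open>(0, -1, 1)\<close>, \<open>(0, -1, -1)\<close>. Points with
  \<open>D = 0\<close> would go to infinity on the quadrics.\<close>

fun ec_to_jac :: "'a::linordered_field \<Rightarrow> 'a \<Rightarrow> 'a ec_point \<Rightarrow> 'a \<times> 'a \<times> 'a" where
  "ec_to_jac p q Infinity = (0, 1, 1)"
| "ec_to_jac p q (Affine x y) =
     (let D = x^2 + 2*q*x + p*q in (2*y / D, (x^2 + 2*p*x + p*q) / D, (x^2 - p*q) / D))"

text \<open>Non-squareness of \<open>q\<close> excludes \<open>d = 0\<close> on the quadrics. That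
  of \<open>q * (q - p)\<close> keeps the denominator of \<open>ec_to_jac\<close> nonzero, because
  this denominator is \<open>(x + q)^2 - q * (q - p)\<close>.\<close>

locale split_curve =
  fixes p q :: "'a::linordered_field"
  assumes p_pos: "0 < p" and p_less_q: "p < q"
    and nonsquare: "\<And>r. r^2 \<noteq> q" "\<And>r. r^2 \<noteq> q * (q - p)"
begin

sublocale jacobi "q - p" q
  using p_pos p_less_q by unfold_locales auto

lemma jac_denominator_nonzero: "x^2 + 2*q*x + p*q \<noteq> 0"
proof
  assume "x^2 + 2*q*x + p*q = 0"
  then have "(x + q)^2 = q * (q - p)" by algebra
  with nonsquare show False by blast
qed

lemma dn_nonzero:
  assumes "(s, c, d) \<in> jac_points (q - p) q"
  shows "d \<noteq> 0"
proof
  assume "d = 0"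
  with assms have *: "q * s^2 = 1" by (auto simp: jac_points_def)
  then have "s \<noteq> 0" by auto
  with * have "(1/s)^2 = q" by (simp add: field_simps)
  with nonsquare show False by blast
qed

abbreviation "curve_points \<equiv> ec_points (p + q) (p * q) 0"
abbreviation "curve_group \<equiv> ec_group (p + q) (p * q) 0"

lemma ec_to_jac_closed:
  assumes "P \<in> curve_points"
  shows "ec_to_jac p q P \<in> jac_points (q - p) q"
proof (cases P)
  case Infinity
  then show ?thesis by (simp add: jac_points_def)
next
  case (Affine x y)
  define D where "D = x^2 + 2*q*x + p*q"
  have "D \<noteq> 0" unfolding D_def by (rule jac_denominator_nonzero)
  have "y^2 = x^3 + (p + q) * x^2 + p * q * x"
    using assms Affine by (auto simp: ec_points_def)
  then have "(q - p) * (2*y)^2 + (x^2 + 2*p*x + p*q)^2 = D^2" "q * (2*y)^2 + (x^2 - p*q)^2 = D^2"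
    unfolding D_def by algebra+
  then have "(q - p) * (2*y/D)^2 + ((x^2 + 2*p*x + p*q)/D)^2 = 1" "q * (2*y/D)^2 + ((x^2 - p*q)/D)^2 = 1"
    using \<open>D \<noteq> 0\<close> by (simp_all add: power_divide flip: add_divide_distrib)
  then show ?thesis
    unfolding Affine ec_to_jac.simps Let_def D_def[symmetric] jac_points_def by simp
qed

text \<open>The first two equations form a linear system for \<open>c3\<close>, \<open>d3\<close>
  with determinant \<open>N\<close>; the third gives \<open>s3\<close> after division by
  \<open>d1\<close>, which is nonzero.\<close>

lemma jac_add_eqI:
  assumes "(s1, c1, d1) \<in> jac_points (q - p) q" "(s2, c2, d2) \<in> jac_points (q - p) q"
    and "c1 * c2 = c3 + (q - p) * s1 * s2 * d3" "d1 * d2 = d3 + q * s1 * s2 * c3"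
    and "s3 * d1 = c1 * s2 + s1 * c2 * d3"
  shows "jac_add (q - p) q (s1, c1, d1) (s2, c2, d2) = (s3, c3, d3)"
proof -
  define N where "N = 1 - (q - p) * q * s1 * s1 * s2 * s2"
  have N: "N \<noteq> 0" using denominator_pos[OF assms(1,2)] by (simp add: N_def)
  have c3: "c1 * c2 - (q - p) * s1 * s2 * d1 * d2 = c3 * N"
    and d3: "d1 * d2 - q * s1 * s2 * c1 * c2 = d3 * N"
    unfolding N_def using assms(3,4) by algebra+
  have eqs: "(q - p) * s2^2 + c2^2 = 1" "q * s1^2 + d1^2 = 1"
    using assms by (auto simp: jac_points_def)
  have "d1 * (s1 * c2 * d2 + s2 * c1 * d1) = d1 * (s3 * N)"
  proof -
    have "d1^2 = N - q * s1^2 * c2^2"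
      using eqs unfolding N_def by algebra
    then have "d1 * (s1 * c2 * d2 + s2 * c1 * d1)
        = s1 * c2 * (d1 * d2 - q * s1 * s2 * c1 * c2) + c1 * s2 * N"
      by algebra
    also have "\<dots> = (c1 * s2 + s1 * c2 * d3) * N"
      unfolding d3 by (simp add: algebra_simps)
    finally show ?thesis unfolding assms(5)[symmetric] by (simp add: mult_ac)
  qed
  then have "s1 * c2 * d2 + s2 * c1 * d1 = s3 * N"
    using dn_nonzero[OF assms(1)] by simp
  with c3 d3 N show ?thesis
    unfolding jac_add.simps Let_def N_def[symmetric] by simp
qed

text \<open>Opposite points go to inverse points. For all other affine pairs the relations of
  \<open>ec_add_line\<close> feed the three identities above, for chord and tangent at once.\<close>

lemma ec_to_jac_add:
  assumes "P \<in> curve_points" "Q \<in> curve_points"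
  shows "ec_to_jac p q (ec_add (p + q) (p * q) P Q)
    = jac_add (q - p) q (ec_to_jac p q P) (ec_to_jac p q Q)"
proof (cases "P = Infinity \<or> Q = Infinity")
  case True
  then show ?thesis
    by (cases P; cases Q) (auto simp: Let_def)
next
  case False
  then obtain x1 y1 x2 y2 where PQ: "P = Affine x1 y1" "Q = Affine x2 y2"
    by (metis ec_point.exhaust)
  show ?thesis
  proof (cases "x1 = x2 \<and> y1 = - y2")
    case True
    obtain s c d where scd: "ec_to_jac p q Q = (s, c, d)" by (metis prod_cases3)
    with True have "ec_to_jac p q P = (- s, c, d)" by (auto simp: PQ Let_def)
    with scd show ?thesis
      using True jac_add_neg[of s c d] ec_to_jac_closed[OF assms(2)] by (simp add: PQ)
  next
    case False
    obtain l n x3 where sum: "ec_add (p + q) (p * q) (Affine x1 y1) (Affine x2 y2) = Affine x3 (- (l * x3 + n))"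
      and y: "y1 = l * x1 + n" "y2 = l * x2 + n"
      and rel: "p + q = l^2 - x1 - x2 - x3" "p * q = x1*x2 + x1*x3 + x2*x3 + 2*l*n" "x1*x2*x3 = n^2"
      using ec_add_line[of x1 y1 "p + q" "p * q" x2 y2] assms False PQ by metis
    define a where "a x = x^2 + 2*q*x + p*q" for x
    define b where "b x = x^2 + 2*p*x + p*q" for x
    define e where "e x = x^2 - p*q" for x
    have a: "a x \<noteq> 0" for x unfolding a_def by (rule jac_denominator_nonzero)
    have jac: "ec_to_jac p q (Affine x z) = (2*z / a x, b x / a x, e x / a x)" for x z
      by (simp add: Let_def a_def b_def e_def)
    have "b x1 * b x2 * a x3 = b x3 * a x1 * a x2 + 4*(q - p) * y1 * y2 * e x3"
      "e x1 * e x2 * a x3 = e x3 * a x1 * a x2 + 4*q * y1 * y2 * b x3"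
      "-(l*x3 + n) * e x1 * a x2 = b x1 * y2 * a x3 + y1 * b x2 * e x3"
      unfolding a_def b_def e_def y
      by (rule ec_add_jacobi_cn[OF rel], rule ec_add_jacobi_dn[OF rel], rule ec_add_jacobi_sn[OF rel])
    note ids = this
    have "jac_add (q - p) q (2*y1 / a x1, b x1 / a x1, e x1 / a x1) (2*y2 / a x2, b x2 / a x2, e x2 / a x2)
      = (2*(-(l*x3 + n)) / a x3, b x3 / a x3, e x3 / a x3)"
    proof (rule jac_add_eqI)
      show "(2*y1 / a x1, b x1 / a x1, e x1 / a x1) \<in> jac_points (q - p) q"
        "(2*y2 / a x2, b x2 / a x2, e x2 / a x2) \<in> jac_points (q - p) q"
        using ec_to_jac_closed[OF assms(1)] ec_to_jac_closed[OF assms(2)] by (simp_all only: PQ jac)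
      show "b x1 / a x1 * (b x2 / a x2) = b x3 / a x3 + (q - p) * (2*y1 / a x1) * (2*y2 / a x2) * (e x3 / a x3)"
        using ids(1) a[of x1] a[of x2] a[of x3]
        by (simp add: divide_simps) (simp add: algebra_simps)
      show "e x1 / a x1 * (e x2 / a x2) = e x3 / a x3 + q * (2*y1 / a x1) * (2*y2 / a x2) * (b x3 / a x3)"
        using ids(2) a[of x1] a[of x2] a[of x3]
        by (simp add: divide_simps)
      show "2*(-(l*x3 + n)) / a x3 * (e x1 / a x1) = b x1 / a x1 * (2*y2 / a x2) + 2*y1 / a x1 * (b x2 / a x2) * (e x3 / a x3)"
        using ids(3) a[of x1] a[of x2] a[of x3]
        by (simp add: divide_simps del: minus_add_distrib) (simp add: algebra_simps)?
    qed
    then show ?thesis by (simp only: PQ sum jac)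
  qed
qed

text \<open>\<open>1 - c\<close> and \<open>1 - d\<close> determine \<open>x / a x\<close> and
  \<open>(x + p) / a x\<close>; their difference \<open>p / a x\<close> recovers \<open>a x\<close>,
  then \<open>x\<close> and \<open>y\<close>.\<close>

lemma ec_to_jac_inj: "inj_on (ec_to_jac p q) curve_points"
proof -
  define a where "a x = x^2 + 2*q*x + p*q" for x
  have a: "a x \<noteq> 0" for x unfolding a_def by (rule jac_denominator_nonzero)
  have cn: "x^2 + 2*p*x + p*q = a x - 2*(q-p)*x" and dn: "x^2 - p*q = a x - 2*q*(x+p)" for x
    by (simp_all add: a_def algebra_simps)
  have jac: "ec_to_jac p q (Affine x y) = (2*y / a x, 1 - 2*(q-p)*x / a x, 1 - 2*q*(x + p) / a x)" for x y
    unfolding ec_to_jac.simps Let_def a_def[symmetric] cn dn using a[of x] by (simp add: diff_divide_distrib)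
  have aff: "Affine x y = Affine x' y'"
    if "ec_to_jac p q (Affine x y) = ec_to_jac p q (Affine x' y')" for x y x' y'
  proof -
    have "2 * (y / a x) = 2 * (y' / a x')" "2*(q - p) * (x / a x) = 2*(q - p) * (x' / a x')"
      "2*q * ((x + p) / a x) = 2*q * ((x' + p) / a x')"
      using that unfolding jac by simp_all
    then have 1: "y / a x = y' / a x'" "x / a x = x' / a x'" "(x + p) / a x = (x' + p) / a x'"
      using p_pos p_less_q by (simp_all only: mult_cancel_left) auto
    then have "p / a x = p / a x'" by (simp add: add_divide_distrib)
    then have "a x = a x'" using p_pos a by (simp add: frac_eq_eq)
    with 1 a show ?thesis by auto
  qed
  have inf: "ec_to_jac p q (Affine x y) \<noteq> ec_to_jac p q Infinity" for x y
    using p_pos p_less_q a[of x] unfolding jac by auto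
  show ?thesis
  proof (rule inj_onI)
    fix P Q assume "ec_to_jac p q P = ec_to_jac p q Q"
    then show "P = Q"
      using aff inf by (cases P; cases Q) metis+
  qed
qed

lemma ec_to_jac_hom: "ec_to_jac p q \<in> hom curve_group (jac_group (q - p) q)"
  by (auto simp: hom_def ec_group_def jac_group_def ec_to_jac_closed ec_to_jac_add)

text \<open>Associativity and commutativity are pulled back along the injection
  \<open>ec_to_jac\<close>; the inverse is written down directly.\<close>

lemma curve_comm_group: "comm_group curve_group"
proof (rule comm_groupI)
  interpret J: comm_group "jac_group (q - p) q" by (rule jac_comm_group)
  note [simp] = ec_group_def jac_group_def
  note eq = inj_onD[OF ec_to_jac_inj]
  note hom = ec_to_jac_add ec_to_jac_closed ec_add_closed
  show "P \<otimes>\<^bsub>curve_group\<^esub> Q \<in> carrier curve_group"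
    if "P \<in> carrier curve_group" "Q \<in> carrier curve_group" for P Q
    using that by (simp add: ec_add_closed)
  show "P \<otimes>\<^bsub>curve_group\<^esub> Q \<otimes>\<^bsub>curve_group\<^esub> R = P \<otimes>\<^bsub>curve_group\<^esub> (Q \<otimes>\<^bsub>curve_group\<^esub> R)"
    if "P \<in> carrier curve_group" "Q \<in> carrier curve_group" "R \<in> carrier curve_group" for P Q R
    using that by (intro eq) (simp_all add: hom jac_add_assoc)
  show "P \<otimes>\<^bsub>curve_group\<^esub> Q = Q \<otimes>\<^bsub>curve_group\<^esub> P"
    if "P \<in> carrier curve_group" "Q \<in> carrier curve_group" for P Q
    using that J.m_comm[of "ec_to_jac p q P" "ec_to_jac p q Q"] by (intro eq) (simp_all add: hom)
  show "\<exists>Q\<in>carrier curve_group. Q \<otimes>\<^bsub>curve_group\<^esub> P = \<one>\<^bsub>curve_group\<^esub>"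
    if "P \<in> carrier curve_group" for P
  proof (cases P)
    case Infinity
    then show ?thesis by (auto simp: ec_points_def)
  next
    case (Affine x y)
    with that have "Affine x (- y) \<in> carrier curve_group" by (simp add: ec_points_def)
    then show ?thesis using Affine by (intro bexI[of _ "Affine x (- y)"]) auto
  qed
qed (auto simp: ec_group_def ec_points_def)

end

section \<open>Abstract descent and rank\<close>

text \<open>
  The step has exponents 4 and 2 instead of 2 and 1 because halving is only possible up to 2-torsion.
\<close>
lemma (in comm_group) descent_multiple:
  fixes h :: "'a \<Rightarrow> nat"
  assumes g: "g \<in> carrier G" and x: "x \<in> carrier G"
    and fin: "\<And>M. finite {y \<in> carrier G. h y \<le> M}"
    and step: "\<And>y. y \<in> carrier G \<Longrightarrow>
      \<exists>z\<in>carrier G. \<exists>n::int. z [^] (4::int) = y [^] (2::int) \<otimes> g [^] n \<and> h z ^ 2 \<le> C * h y"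
  shows "\<exists>(k::int) (m::int). k \<noteq> 0 \<and> x [^] k = g [^] m"
proof -
  obtain f n where f: "\<And>y. y \<in> carrier G \<Longrightarrow> f y \<in> carrier G"
      "\<And>y. y \<in> carrier G \<Longrightarrow> f y [^] (4::int) = y [^] (2::int) \<otimes> g [^] (n y :: int)"
      "\<And>y. y \<in> carrier G \<Longrightarrow> h (f y) ^ 2 \<le> C * h y"
    using step by metis
  \<comment> \<open>A height of at most \<open>M\<close> stays so under \<open>f\<close>:
    \<open>h (f y)^2 \<le> C * h y \<le> M * M\<close>.\<close>
  define M where "M = max C (h x)"
  define z where "z i = (f ^^ i) x" for i
  have z_Suc: "z (Suc i) = f (z i)" for i by (simp add: z_def)
  have z: "z i \<in> carrier G" for i
    by (induction i) (simp_all add: z_Suc f x, simp add: z_def x)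
  have bounded: "h (z i) \<le> M" for i
  proof (induction i)
    case (Suc i)
    have "h (z (Suc i)) ^ 2 \<le> C * h (z i)" using f z z_Suc by simp
    also have "\<dots> \<le> M * M" using Suc by (intro mult_mono) (auto simp: M_def)
    finally show ?case by (simp add: power2_eq_square[symmetric])
  qed (simp add: z_def M_def)
  \<comment> \<open>Raising the step relation for \<open>z i\<close> to the power \<open>2^i\<close>
    carries the exponent \<open>2 * 2^i\<close> to \<open>2 * 2^Suc i\<close>.\<close>
  have mult: "\<exists>m::int. z i [^] (2 * 2^i :: int) = x [^] (2::int) \<otimes> g [^] m" for i
  proof (induction i)
    case 0
    show ?case by (rule exI[of _ 0]) (simp add: z_def x)
  next
    case (Suc i)
    then obtain m :: int where m: "z i [^] (2 * 2^i :: int) = x [^] (2::int) \<otimes> g [^] m" by blast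
    have "z (Suc i) [^] (2 * 2^Suc i :: int) = (f (z i) [^] (4::int)) [^] (2^i :: int)"
      by (simp add: int_pow_pow f(1) z z_Suc)
    also have "\<dots> = z i [^] (2 * 2^i :: int) \<otimes> g [^] (n (z i) * 2^i)"
      unfolding f(2)[OF z] by (simp add: z g int_pow_distrib int_pow_pow)
    also have "\<dots> = x [^] (2::int) \<otimes> g [^] (m + n (z i) * 2^i)"
      by (simp add: m x g m_assoc int_pow_mult)
    finally show ?case by blast
  qed
  \<comment> \<open>Pigeonhole: infinitely many indices, finitely many elements of height at most
    \<open>M\<close>.\<close>
  have "finite (range z)"
    using fin[of M] by (rule finite_subset[rotated]) (use z bounded in auto)
  then have "\<not> inj z" using finite_imageD infinite_UNIV_nat by blast
  then obtain i j where "i \<noteq> j" "z i = z j" by (auto simp: inj_def)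
  then obtain i j where ij: "i < j" "z i = z j" by (metis nat_neq_iff)
  obtain m m' :: int where m: "z i [^] (2 * 2^i :: int) = x [^] (2::int) \<otimes> g [^] m"
      "z j [^] (2 * 2^j :: int) = x [^] (2::int) \<otimes> g [^] m'"
    using mult by meson
  \<comment> \<open>Comparing the two relations at \<open>z i = z j\<close> expresses
    \<open>x [^] (2 * r - 2)\<close> by \<open>g\<close>, and this exponent is nonzero because
    \<open>r \<ge> 2\<close>.\<close>
  define r where "r = (2::int) ^ (j - i)"
  have "r \<ge> 2" using ij self_le_power[of "2::int" "j - i"] by (simp add: r_def)
  have "(2::int) * 2^j = 2 * 2^i * r" using ij by (simp add: r_def flip: power_add)
  then have "z i [^] (2 * 2^j :: int) = (z i [^] (2 * 2^i :: int)) [^] r"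
    by (simp only: int_pow_pow z)
  then have "x [^] (2::int) \<otimes> g [^] m' = x [^] (2 * r) \<otimes> g [^] (m * r)"
    using m ij by (simp add: int_pow_distrib int_pow_pow x g)
  then have "x [^] (2 * r) = x [^] (2::int) \<otimes> g [^] (m' - m * r)"
    using x g by (simp add: int_pow_diff m_assoc[symmetric] inv_solve_right)
  then have "x [^] (2 * r) = g [^] (m' - m * r) \<otimes> x [^] (2::int)"
    using x g by (simp add: m_comm)
  then have "x [^] (2 * r - 2) = g [^] (m' - m * r)"
    using x g by (simp add: int_pow_diff m_assoc)
  moreover have "2 * r - 2 \<noteq> 0" using \<open>r \<ge> 2\<close> by simp
  ultimately show ?thesis by blast
qed

text \<open>\<open>{g}\<close> is independent. Two elements never are: \<open>x^k = g^m\<close> and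
  \<open>y^k' = g^m'\<close> give \<open>x^(k*m') = y^(k'*m)\<close>.\<close>

lemma (in comm_group) abelian_rank_eq_1I:
  assumes g: "g \<in> carrier G" and inf: "\<And>k::int. k \<noteq> 0 \<Longrightarrow> g [^] k \<noteq> \<one>"
    and mult: "\<And>x. x \<in> carrier G \<Longrightarrow> \<exists>(k::int) (m::int). k \<noteq> 0 \<and> x [^] k = g [^] m"
  shows "abelian_rank G = 1"
proof (rule antisym)
  have "int_independent G {g}"
    using g inf by (auto simp: int_independent_def)
  then show "1 \<le> abelian_rank G"
    unfolding abelian_rank_def by (intro SUP_upper2[of "{g}"]) (auto simp: one_enat_def)
  show "abelian_rank G \<le> 1"
    unfolding abelian_rank_def
  proof (rule SUP_least)
    fix S assume "S \<in> {S. int_independent G S}"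
    then have fin: "finite S" and sub: "S \<subseteq> carrier G"
      and ind: "\<And>c :: 'a \<Rightarrow> int. finprod G (\<lambda>x. x [^] c x) S = \<one> \<Longrightarrow> \<forall>x\<in>S. c x = 0"
      by (auto simp: int_independent_def)
    have False if xy: "x \<in> S" "y \<in> S" "x \<noteq> y" for x y
    proof -
      have [simp]: "x \<in> carrier G" "y \<in> carrier G" using xy sub by auto
      have dep: "u = 0 \<and> v = 0" if "x [^] u \<otimes> y [^] v = \<one>" for u v :: int
      proof -
        define c where "c = (\<lambda>_. 0)(x := u, y := v)"
        have "finprod G (\<lambda>z. z [^] c z) S = finprod G (\<lambda>z. z [^] c z) {x, y}"
          using fin sub xy by (intro finprod_mono_neutral_cong_right) (auto simp: c_def)
        also have "\<dots> = x [^] u \<otimes> y [^] v"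
          using xy by (simp add: c_def)
        finally show ?thesis using ind[of c] that xy by (auto simp: c_def)
      qed
      obtain k m :: int where "k \<noteq> 0" "x [^] k = g [^] m" using mult[of x] by auto
      moreover obtain k' m' :: int where "k' \<noteq> 0" "y [^] k' = g [^] m'" using mult[of y] by auto
      ultimately have km: "k \<noteq> 0" "x [^] k = g [^] m" "k' \<noteq> 0" "y [^] k' = g [^] m'" by auto
      have "x [^] (k * m') \<otimes> y [^] (- (k' * m)) = g [^] (m * m') \<otimes> inv (g [^] (m' * m))"
        using g by (simp add: int_pow_pow[symmetric] km int_pow_neg)
      also have "\<dots> = \<one>" using g by (simp add: mult.commute)
      \<comment> \<open>Independence gives \<open>k' * m = 0\<close>, hence \<open>m = 0\<close>;
        then \<open>x [^] k = \<one>\<close> with \<open>k \<noteq> 0\<close> is again a forbidden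
        relation.\<close>
      finally have "m = 0" using dep km by fastforce
      then have "x [^] k \<otimes> y [^] (0::int) = \<one>" using km by simp
      then show False using dep km by blast
    qed
    then have "card S \<le> 1" using fin by (metis card_le_Suc0_iff_eq One_nat_def)
    then show "enat (card S) \<le> 1" by (simp add: one_enat_def)
  qed
qed

section \<open>Integer squares\<close>

lemma coprime_product_square:
  fixes X Y w :: int
  assumes "coprime X Y" "X * Y = w^2" "0 < X" "0 < Y"
  obtains u v where "X = u^2" "Y = v^2"
proof -
  have "is_nth_power 2 (nat X * nat Y)"
    using assms by (intro is_nth_powerI[of _ "nat \<bar>w\<bar>"]) (simp add: nat_mult_distrib[symmetric] nat_power_eq[symmetric])
  then have "is_nth_power 2 (nat X)" "is_nth_power 2 (nat Y)"
    using assms is_nth_power_mult_coprime_natD[of "nat X" "nat Y" 2] by (auto simp: coprime_int_iff[symmetric])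
  then obtain u v where "nat X = u^2" "nat Y = v^2" by (auto elim!: is_nth_powerE)
  then have "X = int u ^ 2" "Y = int v ^ 2" using assms by (metis int_nat_eq of_nat_power less_imp_le)+
  then show ?thesis using that by blast
qed

text \<open>A common prime factor \<open>r\<close> does not divide \<open>w\<close>, so
  \<open>r^2\<close> could divide \<open>l * w^2\<close> only by dividing the prime
  \<open>l\<close>.\<close>

lemma coprime_product_prime_square:
  fixes X Y w l :: int
  assumes "prime l" "X * Y = l * w^2" "\<And>r. prime r \<Longrightarrow> r dvd X \<Longrightarrow> r dvd Y \<Longrightarrow> \<not> r dvd w"
  shows "coprime X Y"
proof (rule ccontr)
  assume "\<not> coprime X Y"
  moreover have "\<not> (X = 0 \<and> Y = 0)"
    using assms(3)[OF assms(1)] assms(2) assms(1) by auto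
  ultimately obtain r where "prime r" "r dvd gcd X Y"
    using prime_divisor_exists[of "gcd X Y"] by auto
  then have r: "prime r" "r dvd X" "r dvd Y" by auto
  then have "r^2 dvd l * w^2" using assms(2) by (metis mult_dvd_mono power2_eq_square)
  moreover have "coprime (r^2) (w^2)"
    using assms(3)[OF r] r(1) by (simp add: prime_imp_coprime)
  ultimately have "r^2 dvd l" by (simp add: coprime_dvd_mult_left_iff)
  then have "r dvd l" by (metis dvd_mult_left power2_eq_square)
  then have "r = l" using r assms(1) primes_dvd_imp_eq by blast
  with \<open>r^2 dvd l\<close> r(1) show False
    by (metis One_nat_def not_prime_unit dvd_times_left_cancel_iff mult.right_neutral not_prime_0 power2_eq_square)
qed

text \<open>Infinite descent: squares are 0 or 1 modulo 4, so \<open>u^2 + g^2 = 3 * n^2\<close>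
  modulo 4 forces all three numbers to be even, and they can be halved.\<close>

lemma sum_two_squares_eq_mult_square:
  fixes u g n q :: int
  assumes "q mod 4 = 3" "u^2 + g^2 = q * n^2"
  shows "n = 0"
  using assms(2)
proof (induction "nat \<bar>n\<bar>" arbitrary: u g n rule: less_induct)
  case less
  have sq: "x^2 mod 4 = (if even x then 0 else 1)" for x :: int
  proof (cases "even x")
    case True
    then obtain b where "x = 2 * b" by blast
    then have "x^2 = 4 * b^2" by algebra
    then show ?thesis using True by simp
  next
    case False
    then obtain b where "x = 2 * b + 1" by (metis oddE)
    then have "x^2 = 1 + 4 * (b^2 + b)" by algebra
    then show ?thesis using False by (simp del: distrib_left_numeral)
  qed
  have "(u^2 mod 4 + g^2 mod 4) mod 4 = (q mod 4) * (n^2 mod 4) mod 4"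
    using less.prems by (simp add: mod_simps)
  then have "even n" "even u" "even g"
    unfolding sq assms(1) by (auto split: if_splits)
  then obtain u' g' n' where div: "u = 2 * u'" "g = 2 * g'" "n = 2 * n'"
    by (metis evenE)
  then have "u'^2 + g'^2 = q * n'^2" using less.prems by algebra
  with less.hyps[of n' u' g'] div show ?case by (cases "n = 0") (auto simp: abs_mult)
qed

lemma Ints_if_square_Ints:
  fixes r :: rat
  assumes "r^2 \<in> \<int>"
  shows "r \<in> \<int>"
proof -
  obtain a b where ab: "quotient_of r = (a, b)" by fastforce
  then have r: "r = of_int a / of_int b" "b > 0" "coprime a b"
    by (simp_all add: quotient_of_div quotient_of_denom_pos quotient_of_coprime)
  from assms obtain n where "r^2 = of_int n" by (auto elim: Ints_cases)
  then have "rat_of_int (a^2) = of_int (n * b^2)" using r by (simp add: field_simps power_divide)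
  then have "a^2 = n * b^2" by (simp only: of_int_eq_iff)
  then have "b^2 dvd a^2" by simp
  moreover have "coprime (a^2) (b^2)" using r by simp
  ultimately have "b^2 dvd 1" by (metis coprime_common_divisor dvd_refl)
  then have "b dvd 1" by (metis dvd_mult_left power2_eq_square)
  then have "b = 1" using r by simp
  then show ?thesis using r by simp
qed

text \<open>The half sums and half differences of the three pairs have products \<open>S^2\<close>,
  \<open>q * (S/2)^2\<close> and \<open>p * (S/2)^2\<close>. The divisibility hypotheses place
  \<open>q\<close> and \<open>p\<close> in the differences, so each half sum is a square up to
  sign.\<close>

lemma even_type_squares:
  fixes S C D Z p q :: int
  assumes pq: "prime p" "prime q" "q = p + 4" "q mod 4 = 3"
    and Z: "0 < Z" and S: "S \<noteq> 0" "even S" "coprime S Z"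
    and eqs: "4 * S^2 + C^2 = Z^2" "q * S^2 + D^2 = Z^2"
    and dvd: "q dvd Z - D" "p dvd C - D"
  obtains u v m g where "Z + C = 2 * u^2" "Z - C = 2 * v^2" "Z + D = 2 * m^2" "C + D = 2 * g^2"
    "S = u * v"
proof -
  have pos: "0 < p" "0 < q" using pq by (auto intro: prime_gt_0_int)
  have "odd Z" using coprime_common_divisor[OF S(3,2)] by auto
  moreover have "even (4 * S^2 + C^2) \<longleftrightarrow> even (Z^2)" "even (q * S^2 + D^2) \<longleftrightarrow> even (Z^2)"
    by (simp_all only: eqs)
  ultimately have "odd C" "odd D" using S(2) by auto
  obtain w where w: "S = 2 * w" using S by blast
  have nodvd: "\<not> (r dvd S \<and> r dvd Z)" if "prime r" for r
    using that S(3) by (metis coprime_common_divisor not_prime_unit)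
  have cancel_q: "q \<noteq> 2" "p \<noteq> 2" using pq(3,4) pos by (auto simp: pq(3))
  have S2: "0 < S^2" using S by simp
  have "C^2 < Z^2" "D^2 < Z^2"
    using eqs S2 pos mult_pos_pos[of q "S^2"] by linarith+
  then have CZ: "\<bar>C\<bar> < Z" "\<bar>D\<bar> < Z"
    using Z by (auto intro: power2_less_imp_less)
  obtain X1 Y1 where 1: "Z + C = 2 * X1" "Z - C = 2 * Y1"
    using \<open>odd Z\<close> \<open>odd C\<close> by (metis evenE odd_even_add even_diff_iff even_add)
  obtain X2 Y2' where 2: "Z + D = 2 * X2" "Z - D = 2 * Y2'"
    using \<open>odd Z\<close> \<open>odd D\<close> by (metis evenE even_diff_iff even_add)
  obtain X3 Y3' where 3: "C + D = 2 * X3" "C - D = 2 * Y3'"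
    using \<open>odd C\<close> \<open>odd D\<close> by (metis evenE even_diff_iff even_add)
  have "q dvd 2 * Y2'" "p dvd 2 * Y3'" using dvd 2 3 by simp_all
  moreover have "\<not> q dvd 2" "\<not> p dvd 2"
    using zdvd_imp_le[of q 2] zdvd_imp_le[of p 2] cancel_q
      prime_gt_1_int[OF pq(1)] prime_gt_1_int[OF pq(2)] by fastforce+
  ultimately have "q dvd Y2'" "p dvd Y3'" using pq(1,2) prime_dvd_mult_iff by blast+
  then obtain Y2 Y3 where Y2: "Y2' = q * Y2" and Y3: "Y3' = p * Y3" by (auto elim!: dvdE)
  have prods: "X1 * Y1 = S^2" "X2 * Y2' = q * w^2" "X3 * Y3' = p * w^2"
  proof -
    have "4 * (X1 * Y1) = 4 * S^2" using 1 eqs by algebra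
    then show "X1 * Y1 = S^2" by simp
    have "4 * (X2 * Y2') = 4 * (q * w^2)" using 2 eqs w by algebra
    then show "X2 * Y2' = q * w^2" by simp
    have "4 * (X3 * Y3') = 4 * (p * w^2)" using 3 eqs w pq(3) by algebra
    then show "X3 * Y3' = p * w^2" by simp
  qed
  have sums: "X1 + Y1 = Z" "X2 + Y2' = Z" "X3 + Y3' = C" using 1 2 3 by auto
  have "coprime X1 Y1"
  proof (rule coprimeI)
    fix r assume "r dvd X1" "r dvd Y1"
    then have "r dvd S^2" "r dvd Z"
      unfolding prods(1)[symmetric] sums(1)[symmetric] by auto
    moreover have "coprime (S^2) Z" using S by simp
    ultimately show "is_unit r" by (metis coprime_common_divisor)
  qed
  have "coprime X2 Y2'"
  proof (rule coprime_product_prime_square[OF pq(2) prods(2)])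
    fix r :: int assume r: "prime r" "r dvd X2" "r dvd Y2'"
    then have "r dvd Z" using sums by (metis dvd_add)
    with r nodvd w show "\<not> r dvd w" by auto
  qed
  have "coprime X3 Y3'"
  proof (rule coprime_product_prime_square[OF pq(1) prods(3)])
    fix r :: int assume r: "prime r" "r dvd X3" "r dvd Y3'"
    then have "r dvd C" using sums by (metis dvd_add)
    \<comment> \<open>Since \<open>S = 2 * w\<close>, such an \<open>r\<close> divides both terms of
      \<open>4 * S^2 + C^2\<close>.\<close>
    then have "r dvd Z^2" if "r dvd w" using that unfolding eqs(1)[symmetric] w by (simp add: power2_eq_square)
    with nodvd[OF r(1)] w show "\<not> r dvd w" using prime_dvd_power[OF r(1), of Z 2] by auto
  qed
  have prods': "X2 * Y2 = w^2" "X3 * Y3 = w^2"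
    using prods(2,3) Y2 Y3 pos by auto
  have co: "coprime X2 Y2" "coprime X3 Y3"
    using \<open>coprime X2 Y2'\<close> \<open>coprime X3 Y3'\<close> Y2 Y3 by auto
  have posX: "0 < X1" "0 < Y1" "0 < X2" "0 < Y2"
    using 1 2 CZ Y2 pos by (auto simp: zero_less_mult_iff abs_less_iff)
      (smt (verit) zero_less_mult_iff)+
  obtain u v where uv: "X1 = u^2" "Y1 = v^2"
    using coprime_product_square[OF \<open>coprime X1 Y1\<close> prods(1)] posX by metis
  obtain m n where mn: "X2 = m^2" "Y2 = n^2"
    using coprime_product_square[OF co(1) prods'(1)] posX by metis
  have w2: "0 < w^2" using w S by simp
  \<comment> \<open>If \<open>X3 = - g^2\<close>, then
    \<open>u^2 + g^2 = (Z + C)/2 - (C + D)/2 = (Z - D)/2 = q * n^2\<close> with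
    \<open>n \<noteq> 0\<close>, which \<open>q mod 4 = 3\<close> excludes.\<close>
  have "0 < X3"
  proof (rule ccontr)
    assume "\<not> 0 < X3"
    with prods'(2) w2 have neg: "0 < - X3" "0 < - Y3"
      by (metis linorder_neqE_linordered_idom mult_eq_0_iff neg_0_less_iff_less order_less_irrefl zero_less_mult_iff)+
    obtain g h where "- X3 = g^2" "- Y3 = h^2"
      using coprime_product_square[of "- X3" "- Y3" w] co(2) prods'(2) neg by auto
    then have "u^2 + g^2 = q * n^2" using 1 2 3 uv mn Y2 by algebra
    then have "n = 0" using sum_two_squares_eq_mult_square pq(4) by blast
    then show False using mn posX by simp
  qed
  then have "0 < Y3" using prods'(2) w2 by (metis zero_less_mult_pos)
  obtain g h where gh: "X3 = g^2" "Y3 = h^2"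
    using coprime_product_square[OF co(2) prods'(2)] \<open>0 < X3\<close> \<open>0 < Y3\<close> by metis
  \<comment> \<open>The sign of \<open>v\<close> is still free and is chosen to give
    \<open>S = u * v\<close>.\<close>
  have "S^2 = (u * v)^2" using prods(1) uv by algebra
  then have "S = u * v \<or> S = u * (- v)" by (simp add: power2_eq_iff)
  then show ?thesis
    using that[of u v m g] that[of u "- v" m g] 1 2 3 uv mn gh by auto
qed

section \<open>Descent on the quadrics\<close>

lemma jac_add_fractions:
  assumes "z1 \<noteq> 0" "z2 \<noteq> 0"
  shows "jac_add \<alpha> \<beta> (s1 / z1, c1 / z1, d1 / z1) (s2 / z2, c2 / z2, d2 / z2) =
    (let N = z1^2 * z2^2 - \<alpha> * \<beta> * s1^2 * s2^2
     in ((s1 * c2 * d2 * z1 + s2 * c1 * d1 * z2) / N,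
         (c1 * c2 * z1 * z2 - \<alpha> * s1 * s2 * d1 * d2) / N,
         (d1 * d2 * z1 * z2 - \<beta> * s1 * s2 * c1 * c2) / N))"
proof -
  define N where "N = z1^2 * z2^2 - \<alpha> * \<beta> * s1^2 * s2^2"
  have M: "1 - \<alpha> * \<beta> * (s1 / z1) * (s1 / z1) * (s2 / z2) * (s2 / z2) = N / (z1^2 * z2^2)"
    using assms by (simp add: N_def diff_divide_distrib power2_eq_square)
  show ?thesis
    unfolding jac_add.simps Let_def M N_def[symmetric]
    using assms by (cases "N = 0") (simp_all add: field_simps power2_eq_square)
qed

text \<open>
  The half-angle formulas \<open>sn\<^sup>2 (x/2) = (1 - cn x) / (1 + dn x)\<close>, \<open>cn\<^sup>2 (x/2) = (cn x + dn x) / (1 + dn x)\<close>,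
  \<open>dn\<^sup>2 (x/2) = (cn x + dn x) / (1 + cn x)\<close>, here with \<open>s = sn / 2\<close> because \<open>\<alpha> = 4\<close>.
\<close>
lemma (in jacobi) jac_half:
  assumes nz: "Z \<noteq> 0" "u \<noteq> 0" "m \<noteq> 0" and \<alpha>: "\<alpha> = 4"
    and eqs: "Z + C = 2 * u^2" "Z - C = 2 * v^2" "Z + D = 2 * m^2" "C + D = 2 * g^2" "S = u * v"
      "\<beta> * S^2 + D^2 = Z^2"
  shows "(v / (2 * m), g / m, g / u) \<in> jac_points \<alpha> \<beta>" (is "?P \<in> _")
    and "jac_add \<alpha> \<beta> (v / (2 * m), g / m, g / u) (v / (2 * m), g / m, g / u) = (S / Z, C / Z, D / Z)"
proof -
  have sq: "C = u^2 - v^2" "Z = u^2 + v^2" "g^2 = m^2 - v^2"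
  proof -
    have "2 * C = 2 * (u^2 - v^2)" "2 * Z = 2 * (u^2 + v^2)" "2 * g^2 = 2 * (m^2 - v^2)"
      using eqs by algebra+
    then show "C = u^2 - v^2" "Z = u^2 + v^2" "g^2 = m^2 - v^2" by simp_all
  qed
  have D: "D = 2 * m^2 - Z" using eqs(3) by simp
  \<comment> \<open>This is \<open>\<beta> * S^2 = (Z - D) * (Z + D)\<close> in terms of
    \<open>u\<close>, \<open>v\<close>, \<open>m\<close>.\<close>
  have "4 * m^2 * (u^2 + v^2 - m^2) = \<beta> * u^2 * v^2"
    using eqs(5,6) D sq(2) by algebra
  note \<beta> = this
  have "\<beta> * v^2 * u^2 + 4 * m^2 * g^2 = 4 * m^2 * u^2"
    using \<beta> sq(3) by algebra
  then have "\<beta> * (v / (2 * m))^2 + (g / u)^2 = 1"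
    using nz by (simp add: power_divide power_mult_distrib divide_simps) (simp add: algebra_simps)
  moreover have "\<alpha> * (v / (2 * m))^2 + (g / m)^2 = 1"
    using nz sq(3) \<alpha> by (simp add: power_divide power_mult_distrib divide_simps)
  ultimately show mem: "?P \<in> jac_points \<alpha> \<beta>" by (simp add: jac_points_def)
  define N where "N = 1 - \<alpha> * \<beta> * (v / (2 * m)) * (v / (2 * m)) * (v / (2 * m)) * (v / (2 * m))"
  \<comment> \<open>The aim is \<open>N = g^2 * Z / (u^2 * m^2)\<close>, of which the three
    numerators of the double are then visible multiples.\<close>
  have "u^2 * (4 * m^4 - \<beta> * v^4) = 4 * m^2 * (g^2 * Z)"
    using \<beta> sq(2,3) by algebra
  moreover have "N = (4 * m^4 - \<beta> * v^4) / (4 * m^4)"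
    using nz \<alpha> by (simp add: N_def power4_eq_xxxx field_simps)
  ultimately have "N = 4 * m^2 * (g^2 * Z) / (u^2 * (4 * m^4))"
    using nz by (metis mult_divide_mult_cancel_left power_not_zero)
  then have N: "N = g^2 * Z / (u^2 * m^2)"
    using nz by (simp add: power4_eq_xxxx power2_eq_square)
  have "N \<noteq> 0" using denominator_pos[OF mem mem, folded N_def] by simp
  then have "g \<noteq> 0" using N by auto
  have "4 * m^4 * D = (4 * m^4 - \<beta> * u^2 * v^2) * m^2"
    using \<beta> D sq(2) by algebra
  then have D': "4 * m^2 * D = 4 * m^4 - \<beta> * u^2 * v^2"
    using nz by (simp add: power4_eq_xxxx power2_eq_square)
  have "g / u * (g / u) - \<beta> * (v / (2 * m)) * (v / (2 * m)) * (g / m) * (g / m)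
      = g^2 * (4 * m^4 - \<beta> * u^2 * v^2) / (4 * m^4 * u^2)"
    using nz by (simp add: field_simps power4_eq_xxxx power2_eq_square)
  also have "\<dots> = D / Z * N"
    unfolding D'[symmetric] N using nz by (simp add: field_simps power4_eq_xxxx power2_eq_square)
  finally have d: "g / u * (g / u) - \<beta> * (v / (2 * m)) * (v / (2 * m)) * (g / m) * (g / m) = D / Z * N" .
  have c: "g / m * (g / m) - \<alpha> * (v / (2 * m)) * (v / (2 * m)) * (g / u) * (g / u) = C / Z * N"
    unfolding N sq(1) using nz \<alpha> by (simp add: field_simps power2_eq_square)
  have s: "v / (2 * m) * (g / m) * (g / u) + v / (2 * m) * (g / m) * (g / u) = S / Z * N"
    unfolding N eqs(5) using nz by (simp add: field_simps power2_eq_square)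
  show "jac_add \<alpha> \<beta> ?P ?P = (S / Z, C / Z, D / Z)"
    unfolding jac_add.simps Let_def N_def[symmetric] s c d using \<open>N \<noteq> 0\<close> by simp
qed

text \<open>Here \<open>\<alpha> = q - p = 4\<close>. Modulo 4, the residue of \<open>q\<close>
  excludes the wrong sign in the halving; modulo 8, it controls the points with odd numerator of
  \<open>s\<close>.\<close>

locale twin_jacobi =
  fixes p q :: int
  assumes prime_p: "prime p" and prime_q: "prime q" and q_eq: "q = p + 4" and q_mod: "q mod 8 = 3"
begin

lemma p_pos: "0 < p" and q_gt_4: "4 < q"
  using prime_gt_0_int[OF prime_p] q_eq by auto

lemma q_odd: "odd q"
  using q_mod by presburger

sublocale jacobi "4 :: rat" "of_int q"
  using q_gt_4 by unfold_locales auto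

abbreviation "J \<equiv> jac_group (4 :: rat) (of_int q)"

sublocale J: comm_group J by (rule jac_comm_group)

lemma q_nonsquare: "(r::rat)^2 \<noteq> of_int q"
proof
  assume r: "r^2 = of_int q"
  then have "r^2 \<in> \<int>" by simp
  then have "r \<in> \<int>" by (rule Ints_if_square_Ints)
  then obtain n where "r = of_int n" by (auto elim: Ints_cases)
  with r have "of_int (n^2) = rat_of_int q" by simp
  then have "n * n = q" by (simp only: of_int_eq_iff power2_eq_square)
  then have "q dvd n * n" by simp
  then have "q dvd n" using prime_dvd_multD[OF prime_q] by blast
  then obtain k where "n = q * k" by blast
  with \<open>n * n = q\<close> have "q * (q * (k * k)) = q * 1" by (simp add: mult_ac)
  then have "q * (k * k) = 1" using q_gt_4 by (simp only: mult_cancel_left) simp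
  then have "q dvd 1" by (metis dvd_triv_left)
  with q_gt_4 show False by simp
qed

section \<open>Integer coordinates and parity\<close>

text \<open>The height for the descent; by \<open>integer_coordinates\<close> the denominator of
  \<open>s\<close> also clears those of \<open>c\<close> and \<open>d\<close>.\<close>

definition denom :: "rat \<times> rat \<times> rat \<Rightarrow> nat" where
  "denom P = nat (snd (quotient_of (fst P)))"

text \<open>\<open>(c * Z)^2 = Z^2 - 4 * S^2\<close> is an integer, and a rational number with
  integer square is an integer; likewise for \<open>d\<close>.\<close>

lemma integer_coordinates:
  assumes "P \<in> carrier J"
  obtains S C D Z :: int where "P = (of_int S / of_int Z, of_int C / of_int Z, of_int D / of_int Z)"
    "0 < Z" "coprime S Z" "4 * S^2 + C^2 = Z^2" "q * S^2 + D^2 = Z^2" "int (denom P) = Z"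
proof -
  obtain s c d where P: "P = (s, c, d)" by (metis prod_cases3)
  obtain S Z where SZ: "quotient_of s = (S, Z)" by fastforce
  then have s: "s = of_int S / of_int Z" "0 < Z" "coprime S Z"
    by (simp_all add: quotient_of_div quotient_of_denom_pos quotient_of_coprime)
  have eqs: "4 * s^2 + c^2 = 1" "of_int q * s^2 + d^2 = 1"
    using assms by (auto simp: P jac_group_def jac_points_def)
  have sZ: "s * of_int Z = of_int S" using s by simp
  have "(c * of_int Z)^2 = of_int (Z^2 - 4 * S^2)" "(d * of_int Z)^2 = of_int (Z^2 - q * S^2)"
    unfolding of_int_diff of_int_mult of_int_power sZ[symmetric] of_int_numeral using eqs by algebra+
  then have "c * of_int Z \<in> \<int>" "d * of_int Z \<in> \<int>" and sq: "(c * of_int Z)^2 = of_int (Z^2 - 4 * S^2)" "(d * of_int Z)^2 = of_int (Z^2 - q * S^2)"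
    by (metis Ints_if_square_Ints Ints_of_int)+
  then obtain C D where CD: "c * of_int Z = of_int C" "d * of_int Z = of_int D"
    by (metis Ints_cases)
  with sq have "of_int (C^2) = rat_of_int (Z^2 - 4 * S^2)" "of_int (D^2) = rat_of_int (Z^2 - q * S^2)" by simp_all
  then have "C^2 = Z^2 - 4 * S^2" "D^2 = Z^2 - q * S^2" by (simp_all only: of_int_eq_iff)
  moreover have "c = of_int C / of_int Z" "d = of_int D / of_int Z" using CD s(2) by (simp_all add: field_simps)
  moreover have "int (denom P) = Z" using SZ s(2) by (simp add: denom_def P)
  ultimately show ?thesis using that[of S Z C D] s P by simp
qed

lemma denom_pos: "0 < denom P"
  by (simp add: denom_def quotient_of_denom_pos')

lemma denom_le:
  assumes "B \<noteq> 0"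
  shows "int (denom (of_int A / of_int B, c, d)) \<le> \<bar>B\<bar>"
proof -
  define s where "s = rat_of_int A / of_int B"
  obtain S Z where SZ: "quotient_of s = (S, Z)" by fastforce
  then have s: "s = of_int S / of_int Z" "0 < Z" "coprime S Z"
    by (simp_all add: quotient_of_div quotient_of_denom_pos quotient_of_coprime)
  have "rat_of_int (A * Z) = of_int (S * B)" using s assms s_def by (simp add: field_simps)
  then have "A * Z = S * B" by (simp only: of_int_eq_iff)
  then have "Z dvd S * B" by (metis dvd_triv_right)
  then have "Z dvd B" using s by (simp add: coprime_dvd_mult_right_iff coprime_commute)
  then show ?thesis using assms SZ s zdvd_imp_le[of Z "\<bar>B\<bar>"]
    by (simp add: denom_def s_def[symmetric])
qed

text \<open>Positive 2-adic valuation of \<open>s\<close>, or \<open>s = 0\<close>. The fraction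
  need not be reduced, so a sum can be tested without finding its lowest terms.\<close>

definition even_type :: "rat \<times> rat \<times> rat \<Rightarrow> bool" where
  "even_type P \<longleftrightarrow> (\<exists>A B :: int. even A \<and> odd B \<and> fst P = of_int A / of_int B)"

lemma even_type_iff:
  assumes "coprime S Z" "0 < Z"
  shows "even_type (of_int S / of_int Z, c, d) \<longleftrightarrow> even S"
proof
  assume "even_type (of_int S / of_int Z, c, d)"
  then obtain A B :: int where AB: "even A" "odd B" "rat_of_int S / of_int Z = of_int A / of_int B"
    by (auto simp: even_type_def)
  then have "B \<noteq> 0" by auto
  then have "rat_of_int (S * B) = of_int (A * Z)" using AB(3) assms by (simp add: field_simps)
  then have "S * B = A * Z" by (simp only: of_int_eq_iff)
  then show "even S" using AB by (metis even_mult_iff)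
next
  assume "even S"
  moreover from this have "odd Z" using coprime_common_divisor[OF assms(1), of 2] by auto
  ultimately show "even_type (of_int S / of_int Z, c, d)" by (auto simp: even_type_def)
qed

lemma add_coordinates:
  assumes "P \<in> carrier J" "Q \<in> carrier J"
    and "P = (of_int S1 / of_int Z1, of_int C1 / of_int Z1, of_int D1 / of_int Z1)"
    and "Q = (of_int S2 / of_int Z2, of_int C2 / of_int Z2, of_int D2 / of_int Z2)"
    and "0 < Z1" "0 < Z2"
  defines "N \<equiv> Z1^2 * Z2^2 - 4 * q * S1^2 * S2^2"
  shows "P \<otimes>\<^bsub>J\<^esub> Q = (of_int (S1 * C2 * D2 * Z1 + S2 * C1 * D1 * Z2) / of_int N,
      of_int (C1 * C2 * Z1 * Z2 - 4 * S1 * S2 * D1 * D2) / of_int N,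
      of_int (D1 * D2 * Z1 * Z2 - q * S1 * S2 * C1 * C2) / of_int N)"
    and "0 < N"
proof -
  show "P \<otimes>\<^bsub>J\<^esub> Q = (of_int (S1 * C2 * D2 * Z1 + S2 * C1 * D1 * Z2) / of_int N,
      of_int (C1 * C2 * Z1 * Z2 - 4 * S1 * S2 * D1 * D2) / of_int N,
      of_int (D1 * D2 * Z1 * Z2 - q * S1 * S2 * C1 * C2) / of_int N)"
    using assms(3-6) by (simp add: jac_group_def jac_add_fractions Let_def N_def del: jac_add.simps)
  have "0 < 1 - 4 * rat_of_int q * (of_int S1 / of_int Z1) * (of_int S1 / of_int Z1) * (of_int S2 / of_int Z2) * (of_int S2 / of_int Z2)"
    using assms(1-4) by (intro denominator_pos) (auto simp: jac_group_def)
  also have "\<dots> = of_int N / (of_int Z1^2 * of_int Z2^2)"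
    using assms(5,6) by (simp add: N_def diff_divide_distrib power2_eq_square)
  finally have "0 < rat_of_int N / (of_int Z1^2 * of_int Z2^2)" .
  moreover have "0 < rat_of_int Z1^2 * of_int Z2^2" using assms(5,6) by simp
  ultimately show "0 < N" by (metis zero_less_divide_iff order_less_asym of_int_0_less_iff)
qed

section \<open>Height estimates and finiteness\<close>

lemma denom_add_le:
  assumes "P \<in> carrier J" "Q \<in> carrier J"
  shows "denom (P \<otimes>\<^bsub>J\<^esub> Q) \<le> denom P ^ 2 * denom Q ^ 2"
proof -
  obtain S1 C1 D1 Z1 where P: "P = (of_int S1 / of_int Z1, of_int C1 / of_int Z1, of_int D1 / of_int Z1)"
    "0 < Z1" "int (denom P) = Z1" using integer_coordinates[OF assms(1)] by metis
  obtain S2 C2 D2 Z2 where Q: "Q = (of_int S2 / of_int Z2, of_int C2 / of_int Z2, of_int D2 / of_int Z2)"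
    "0 < Z2" "int (denom Q) = Z2" using integer_coordinates[OF assms(2)] by metis
  define N where "N = Z1^2 * Z2^2 - 4 * q * S1^2 * S2^2"
  note sum = add_coordinates[OF assms P(1) Q(1) P(2) Q(2), folded N_def]
  have "int (denom (P \<otimes>\<^bsub>J\<^esub> Q)) \<le> \<bar>N\<bar>"
    unfolding sum(1) using sum(2) by (intro denom_le) simp
  also have "\<dots> \<le> Z1^2 * Z2^2" using sum(2) q_gt_4 by (simp add: N_def)
  also have "\<dots> = int (denom P ^ 2 * denom Q ^ 2)" using P Q by simp
  finally show ?thesis by linarith
qed

text \<open>The unreduced denominator \<open>N\<close> of the double is at least
  \<open>p * Z^4 / q\<close> and divides \<open>8 * p * q * Z'\<close>, so cancellation costs only a
  constant factor.\<close>

lemma denom_double_ge: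
  assumes "P \<in> carrier J"
  shows "denom P ^ 4 \<le> 8 * nat q ^ 2 * denom (P \<otimes>\<^bsub>J\<^esub> P)"
proof -
  obtain S C D Z where P: "P = (of_int S / of_int Z, of_int C / of_int Z, of_int D / of_int Z)"
    "0 < Z" "coprime S Z" "4 * S^2 + C^2 = Z^2" "q * S^2 + D^2 = Z^2" "int (denom P) = Z"
    using integer_coordinates[OF assms] by metis
  obtain S' C' D' Z' where P': "P \<otimes>\<^bsub>J\<^esub> P = (of_int S' / of_int Z', of_int C' / of_int Z', of_int D' / of_int Z')"
    "0 < Z'" "int (denom (P \<otimes>\<^bsub>J\<^esub> P)) = Z'"
    using integer_coordinates[OF J.m_closed[OF assms assms]] by metis
  define N where "N = Z^2 * Z^2 - 4 * q * S^2 * S^2"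
  note sum = add_coordinates[OF assms assms P(1) P(1) P(2) P(2), folded N_def]
  have "rat_of_int C' / of_int Z' = of_int (C * C * Z * Z - 4 * S * S * D * D) / of_int N"
    "rat_of_int D' / of_int Z' = of_int (D * D * Z * Z - q * S * S * C * C) / of_int N"
    using sum(1) unfolding P'(1) by simp_all
  then have "rat_of_int (C' * N) = of_int ((C * C * Z * Z - 4 * S * S * D * D) * Z')"
    "rat_of_int (D' * N) = of_int ((D * D * Z * Z - q * S * S * C * C) * Z')"
    unfolding of_int_mult using P'(2) sum(2) by (simp_all add: frac_eq_eq)
  then have "C' * N = (C * C * Z * Z - 4 * S * S * D * D) * Z'" "D' * N = (D * D * Z * Z - q * S * S * C * C) * Z'"
    by (simp_all only: of_int_eq_iff)
  \<comment> \<open>\<open>N\<close> divides \<open>2 p S\<^sup>2 Z\<^sup>2 Z'\<close>, so reduction to the denominator \<open>Z'\<close> cancels only a bounded factor of \<open>N\<close>\<close>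
  then have "(C' - D') * N = 2 * p * Z^2 * Z' * S^2"
    using P(4,5) q_eq by algebra
  then have "N dvd 2 * p * Z^2 * Z' * S^2" by (metis dvd_triv_right)
  moreover have cop: "coprime N S"
  proof (rule coprimeI)
    fix r assume "r dvd N" "r dvd S"
    then have "r dvd N + 4 * q * S^2 * S^2" by (simp add: power2_eq_square)
    then have "r dvd Z^4" by (simp add: N_def power4_eq_xxxx power2_eq_square mult.assoc)
    moreover have "coprime S (Z^4)" using P by simp
    ultimately show "is_unit r" using \<open>r dvd S\<close> by (metis coprime_common_divisor)
  qed
  ultimately have "N dvd 2 * p * Z^2 * Z'" by (simp add: coprime_dvd_mult_left_iff)
  \<comment> \<open>Modulo \<open>N\<close>, \<open>Z^4\<close> is \<open>4 * q * S^4\<close>; this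
    trades the powers of \<open>Z\<close> for a power of \<open>S\<close>, which is coprime to
    \<open>N\<close>.\<close>
  then have "N dvd 2 * p * Z^2 * Z' * Z^2 - 2 * p * Z' * N" by (intro dvd_diff) auto
  also have "2 * p * Z^2 * Z' * Z^2 - 2 * p * Z' * N = 8 * p * q * Z' * S^4"
    unfolding N_def by algebra
  finally have "N dvd 8 * p * q * Z'" using cop by (simp add: coprime_dvd_mult_left_iff)
  then have "N \<le> 8 * p * q * Z'" using p_pos q_gt_4 P'(2) by (intro zdvd_imp_le) auto
  then have "q * N \<le> q * (8 * p * q * Z')" using q_gt_4 by simp
  \<comment> \<open>The surplus \<open>4 * (Z^4 - q^2 * S^4)\<close> is nonnegative because
    \<open>q * S^2 \<le> Z^2\<close>.\<close>
  moreover have "p * Z^4 \<le> q * N"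
  proof -
    have "0 \<le> D^2" by simp
    then have "q * S^2 \<le> Z^2" using P(5) by linarith
    moreover have "0 \<le> q * S^2" using q_gt_4 by simp
    ultimately have "(q * S^2)^2 \<le> (Z^2)^2" by (rule power_mono)
    moreover have "q * N = p * Z^4 + 4 * ((Z^2)^2 - (q * S^2)^2)"
      unfolding N_def q_eq by algebra
    ultimately show ?thesis by simp
  qed
  ultimately have "p * Z^4 \<le> q * (8 * p * q * Z')" by simp
  also have "\<dots> = p * (8 * q^2 * Z')" by algebra
  finally have "Z^4 \<le> 8 * q^2 * Z'" using p_pos by simp
  then have "int (denom P ^ 4) \<le> int (8 * nat q ^ 2 * denom (P \<otimes>\<^bsub>J\<^esub> P))"
    using P(6) P'(3) q_gt_4 by simp
  then show ?thesis by linarith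
qed

text \<open>Northcott property: both equations write \<open>Z^2\<close> as a sum of nonnegative
  terms, so \<open>Z\<close> bounds \<open>S\<close>, \<open>C\<close> and \<open>D\<close>
  too.\<close>

lemma finite_denom_le: "finite {P \<in> carrier J. denom P \<le> M}"
proof -
  define F where "F = (\<lambda>(a, b). rat_of_int a / of_int b) ` ({- int M..int M} \<times> {1..int M})"
  have "finite F" by (simp add: F_def)
  moreover have "{P \<in> carrier J. denom P \<le> M} \<subseteq> F \<times> F \<times> F"
  proof
    fix P assume "P \<in> {P \<in> carrier J. denom P \<le> M}"
    then have P: "P \<in> carrier J" "denom P \<le> M" by auto
    obtain S C D Z where *: "P = (of_int S / of_int Z, of_int C / of_int Z, of_int D / of_int Z)"
      "0 < Z" "4 * S^2 + C^2 = Z^2" "q * S^2 + D^2 = Z^2" "int (denom P) = Z"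
      using integer_coordinates[OF P(1)] by metis
    have "0 \<le> q * S^2" using q_gt_4 by simp
    then have "S^2 \<le> Z^2" "C^2 \<le> Z^2" "D^2 \<le> Z^2"
      using *(3,4) zero_le_power2[of S] zero_le_power2[of C] by linarith+
    then have "\<bar>S\<bar> \<le> Z" "\<bar>C\<bar> \<le> Z" "\<bar>D\<bar> \<le> Z"
      using *(2) by (simp_all add: abs_le_square_iff[symmetric])
    moreover have "Z \<le> int M" using * P by simp
    ultimately have "(S, Z) \<in> {- int M..int M} \<times> {1..int M}" "(C, Z) \<in> {- int M..int M} \<times> {1..int M}"
      "(D, Z) \<in> {- int M..int M} \<times> {1..int M}" using *(2) by auto
    then show "P \<in> F \<times> F \<times> F" unfolding *(1) F_def by force
  qed
  ultimately show ?thesis by (meson finite_SigmaI finite_subset)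
qed

section \<open>The subgroup of points of even type\<close>

text \<open>Odd squares are 1 modulo 8. An odd \<open>Z\<close> would make \<open>C^2\<close> equal
  to 5 modulo 8. With \<open>Z = 2 * x\<close> the number \<open>D\<close> is odd, and
  \<open>4 * x^2 = q * S^2 + D^2\<close> is 4 modulo 8, so \<open>x\<close> is odd; then
  \<open>S^2 + (C/2)^2 = x^2\<close> makes \<open>C/2\<close> even.\<close>

lemma odd_coordinates:
  fixes S C D Z :: int
  assumes "4 * S^2 + C^2 = Z^2" "q * S^2 + D^2 = Z^2" "odd S"
  obtains x y where "Z = 2 * x" "odd x" "C = 4 * y"
proof -
  have sq: "\<exists>k. x^2 = 8 * k + 1" if "odd x" for x :: int
  proof -
    obtain b where b: "x = 2 * b + 1" using \<open>odd x\<close> by (metis oddE)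
    have "even (b * (b + 1))" by simp
    then obtain k where "b * (b + 1) = 2 * k" by blast
    then have "x^2 = 8 * k + 1" unfolding b by algebra
    then show ?thesis by blast
  qed
  obtain b where b: "S^2 = 8 * b + 1" using sq assms(3) by blast
  have "even Z"
  proof (rule ccontr)
    assume "odd Z"
    then obtain a where a: "Z^2 = 8 * a + 1" using sq by blast
    then have *: "C^2 = 8 * (a - 4 * b) - 3" using assms(1) b by simp
    then have "odd (C^2)" by simp
    then obtain c where "C^2 = 8 * c + 1" using sq by auto
    with * show False by presburger
  qed
  then obtain x where x: "Z = 2 * x" by blast
  have "even (C^2)" using assms(1) x by (metis dvd_add_right_iff even_mult_iff even_numeral even_power zero_less_numeral)
  then obtain y where y: "C = 2 * y" by (auto elim!: evenE)
  have xy: "S^2 + y^2 = x^2" using assms(1) x y by (simp add: power_mult_distrib)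
  obtain t where t: "q = 8 * t + 3" using q_mod by (metis mult_div_mod_eq)
  have "odd (D^2)"
  proof
    assume "even (D^2)"
    then have "even (q * S^2)" using assms(2) x by (metis dvd_add_left_iff even_mult_iff even_numeral even_power zero_less_numeral)
    then show False using t assms(3) by simp
  qed
  then obtain d where "D^2 = 8 * d + 1" using sq by auto
  then have "4 * x^2 = 4 * (2 * (8 * t * b + t + 3 * b + d) + 1)"
    using assms(2) unfolding x t b by algebra
  then have "x^2 = 2 * (8 * t * b + t + 3 * b + d) + 1" by simp
  then have "odd (x^2)" by simp
  then have "odd x" by simp
  then have "even (y^2)" using xy assms(3) by (metis even_add even_power zero_less_numeral)
  then obtain z where "y = 2 * z" by (auto elim!: evenE)
  then have "C = 4 * z" using y by simp
  with x \<open>odd x\<close> show ?thesis using that by blast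
qed

text \<open>With \<open>even_type_inv\<close> this yields a subgroup of index at most 2. For two odd
  points, \<open>odd_coordinates\<close> exhibits a common factor 4, whose cancellation leaves an
  even numerator and an odd denominator.\<close>

lemma even_type_add:
  assumes "P \<in> carrier J" "Q \<in> carrier J" "even_type P \<longleftrightarrow> even_type Q"
  shows "even_type (P \<otimes>\<^bsub>J\<^esub> Q)"
proof -
  obtain S1 C1 D1 Z1 where P: "P = (of_int S1 / of_int Z1, of_int C1 / of_int Z1, of_int D1 / of_int Z1)"
    "0 < Z1" "coprime S1 Z1" "4 * S1^2 + C1^2 = Z1^2" "q * S1^2 + D1^2 = Z1^2"
    using integer_coordinates[OF assms(1)] by metis
  obtain S2 C2 D2 Z2 where Q: "Q = (of_int S2 / of_int Z2, of_int C2 / of_int Z2, of_int D2 / of_int Z2)"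
    "0 < Z2" "coprime S2 Z2" "4 * S2^2 + C2^2 = Z2^2" "q * S2^2 + D2^2 = Z2^2"
    using integer_coordinates[OF assms(2)] by metis
  define A where "A = S1 * C2 * D2 * Z1 + S2 * C1 * D1 * Z2"
  define N where "N = Z1^2 * Z2^2 - 4 * q * S1^2 * S2^2"
  have sum: "fst (P \<otimes>\<^bsub>J\<^esub> Q) = of_int A / of_int N" "0 < N"
    using add_coordinates[OF assms(1,2) P(1) Q(1) P(2) Q(2)] by (simp_all add: A_def N_def)
  have S12: "even S1 \<longleftrightarrow> even S2" using assms(3) P Q even_type_iff by simp
  show ?thesis
  proof (cases "even S1")
    case True
    then have "odd Z1" "odd Z2" using S12 P(3) Q(3) coprime_common_divisor[of _ _ 2] by fastforce+
    then have "even A" "odd N" using True S12 by (simp_all add: A_def N_def)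
    then show ?thesis using sum by (auto simp: even_type_def)
  next
    case False
    obtain x1 y1 where 3: "Z1 = 2 * x1" "odd x1" "C1 = 4 * y1"
      using odd_coordinates[OF P(4,5) False] by metis
    obtain x2 y2 where 4: "Z2 = 2 * x2" "odd x2" "C2 = 4 * y2"
      using odd_coordinates[OF Q(4,5)] False S12 by metis
    define A' where "A' = 2 * (S1 * y2 * D2 * x1 + S2 * y1 * D1 * x2)"
    define N' where "N' = 4 * x1^2 * x2^2 - q * S1^2 * S2^2"
    have "A = 4 * A'" unfolding A_def A'_def 3 4 by algebra
    moreover have "N = 4 * N'" unfolding N_def N'_def 3 4 by algebra
    ultimately have "fst (P \<otimes>\<^bsub>J\<^esub> Q) = of_int A' / of_int N'"
      using sum(1) by simp
    moreover have "odd N'" using False S12 q_odd by (simp add: N'_def)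
    moreover have "even A'" by (simp add: A'_def)
    ultimately show ?thesis unfolding even_type_def by blast
  qed
qed

lemma even_type_inv:
  assumes "P \<in> carrier J" "even_type P"
  shows "even_type (inv\<^bsub>J\<^esub> P)"
proof -
  obtain s c d where P: "P = (s, c, d)" by (metis prod_cases3)
  from assms(2) obtain A B :: int where "even A" "odd B" "s = of_int A / of_int B"
    by (auto simp: even_type_def P)
  then have "even (- A) \<and> odd B \<and> - s = of_int (- A) / of_int B" by simp
  moreover have "fst (inv\<^bsub>J\<^esub> P) = - s" using assms(1) inv_jac by (simp add: P)
  ultimately show ?thesis unfolding even_type_def by metis
qed

section \<open>Halving up to 2-torsion and the descent\<close>

lemma torsion_square:
  assumes "T \<in> carrier J" "fst T = 0"
  shows "T \<otimes>\<^bsub>J\<^esub> T = \<one>\<^bsub>J\<^esub>"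
  using assms by (cases T) (auto simp: jac_group_def jac_points_def Let_def power2_eq_square)

text \<open>Signs \<open>e\<close>, \<open>f\<close> are chosen such that \<open>q\<close> divides
  \<open>Z - e * D\<close> and \<open>p\<close> divides \<open>e * D - f * C\<close>. Adding
  \<open>T = (0, f, e)\<close> changes \<open>C\<close>, \<open>D\<close> to \<open>f * C\<close>,
  \<open>e * D\<close>, and \<open>even_type_squares\<close> with \<open>jac_half\<close> produces
  the half \<open>R\<close>.\<close>

lemma even_type_double_plus_sign:
  assumes "P \<in> carrier J" "even_type P"
  shows "\<exists>T\<in>carrier J. \<exists>R\<in>carrier J. fst T = 0 \<and> R \<otimes>\<^bsub>J\<^esub> R = P \<otimes>\<^bsub>J\<^esub> T"
proof -
  obtain S C D Z where P: "P = (of_int S / of_int Z, of_int C / of_int Z, of_int D / of_int Z)"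
    "0 < Z" "coprime S Z" "4 * S^2 + C^2 = Z^2" "q * S^2 + D^2 = Z^2"
    using integer_coordinates[OF assms(1)] by metis
  have "even S" using assms(2) P even_type_iff by simp
  show ?thesis
  proof (cases "S = 0")
    case True
    then have "fst P = 0" "P \<otimes>\<^bsub>J\<^esub> P = \<one>\<^bsub>J\<^esub>"
      using P(1) torsion_square[OF assms(1)] by simp_all
    \<comment> \<open>A point with \<open>s = 0\<close> serves as its own \<open>T\<close>, with the
      identity as \<open>R\<close>.\<close>
    then show ?thesis using assms(1) by (intro bexI[of _ P] bexI[of _ "\<one>\<^bsub>J\<^esub>"]) auto
  next
    case False
    have dvd_sign: "\<exists>e::int. (e = 1 \<or> e = -1) \<and> l dvd x - e * y"
      if "prime l" "l dvd (x - y) * (x + y)" for l x y :: int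
      using that by (auto simp: prime_dvd_mult_iff intro: exI[of _ 1] exI[of _ "-1"])
    have "(Z - D) * (Z + D) = q * S^2" using P(5) by algebra
    then obtain e :: int where e: "e = 1 \<or> e = -1" "q dvd Z - e * D"
      using dvd_sign[OF prime_q] by (metis dvd_triv_left)
    have "(e * D - C) * (e * D + C) = p * (- (S^2))"
      using P(4,5) e(1) q_eq by algebra
    then obtain f :: int where f: "f = 1 \<or> f = -1" "p dvd e * D - f * C"
      using dvd_sign[OF prime_p] by (metis dvd_triv_left)
    define S' C' D' where "S' = e * f * S" and "C' = f * C" and "D' = e * D"
    have eqs: "4 * S'^2 + C'^2 = Z^2" "q * S'^2 + D'^2 = Z^2"
      using P(4,5) e(1) f(1) by (auto simp: S'_def C'_def D'_def)
    have S': "S' \<noteq> 0" "even S'" "coprime S' Z"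
      using False \<open>even S\<close> P(3) e(1) f(1) by (auto simp: S'_def)
    have "q mod 4 = 3" using q_mod by presburger
    moreover have "q dvd Z - D'" "p dvd C' - D'"
      using e f by (simp_all add: C'_def D'_def dvd_diff_commute)
    ultimately obtain u v m g where *: "Z + C' = 2 * u^2" "Z - C' = 2 * v^2" "Z + D' = 2 * m^2"
      "C' + D' = 2 * g^2" "S' = u * v"
      using even_type_squares[OF prime_p prime_q q_eq _ P(2) S' eqs] by metis
    have "m \<noteq> 0"
    proof
      assume "m = 0"
      then have "q * S'^2 = 0" using *(3) eqs(2) by algebra
      then show False using S'(1) q_gt_4 by simp
    qed
    moreover have "u \<noteq> 0" using * S' by auto
    moreover define T :: "rat \<times> rat \<times> rat" where "T = (0, of_int f, of_int e)"
    have "rat_of_int Z + of_int C' = 2 * of_int u^2" "rat_of_int Z - of_int C' = 2 * of_int v^2"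
      "rat_of_int Z + of_int D' = 2 * of_int m^2" "rat_of_int C' + of_int D' = 2 * of_int g^2"
      "rat_of_int S' = of_int u * of_int v" "rat_of_int q * of_int S'^2 + of_int D'^2 = of_int Z^2"
      using *[THEN arg_cong[of _ _ rat_of_int]] eqs(2)[THEN arg_cong[of _ _ rat_of_int]] by simp_all
    note half = jac_half[OF _ _ _ refl this]
    define R :: "rat \<times> rat \<times> rat" where "R = (of_int v / (2 * of_int m), of_int g / of_int m, of_int g / of_int u)"
    have "R \<in> carrier J" "R \<otimes>\<^bsub>J\<^esub> R = (of_int S' / of_int Z, of_int C' / of_int Z, of_int D' / of_int Z)"
      using half \<open>m \<noteq> 0\<close> \<open>u \<noteq> 0\<close> P(2) by (simp_all add: R_def jac_group_def del: jac_add.simps)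
    moreover have "P \<otimes>\<^bsub>J\<^esub> T = (of_int S' / of_int Z, of_int C' / of_int Z, of_int D' / of_int Z)"
      by (simp add: P(1) T_def jac_group_def Let_def S'_def C'_def D'_def)
    moreover have "T \<in> carrier J" "fst T = 0"
      using e(1) f(1) by (auto simp: T_def jac_group_def jac_points_def)
    ultimately show ?thesis by (intro bexI[of _ T] bexI[of _ R]) auto
  qed
qed

lemma denom_add_torsion_le:
  assumes "P \<in> carrier J" "T \<in> carrier J" "fst T = 0"
  shows "denom (P \<otimes>\<^bsub>J\<^esub> T) \<le> denom P"
proof -
  have "denom T = 1" using assms(3) by (simp add: denom_def)
  obtain S C D Z where P: "P = (of_int S / of_int Z, of_int C / of_int Z, of_int D / of_int Z)"
    "0 < Z" "int (denom P) = Z" using integer_coordinates[OF assms(1)] by metis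
  obtain c d where T: "T = (0, c, d)" using assms(3) by (metis prod.collapse)
  have "c^2 = 1" "d^2 = 1" using assms(2) by (auto simp: T jac_group_def jac_points_def)
  then have "c * d = 1 \<or> c * d = - 1" by (auto simp: power2_eq_1_iff)
  then have "fst (P \<otimes>\<^bsub>J\<^esub> T) = of_int S / of_int Z \<or> fst (P \<otimes>\<^bsub>J\<^esub> T) = of_int (- S) / of_int Z"
    by (auto simp: P(1) T jac_group_def Let_def mult.assoc)
  then have "int (denom (P \<otimes>\<^bsub>J\<^esub> T)) \<le> \<bar>Z\<bar>"
    using denom_le[of Z] P(2) by (metis denom_def fst_conv less_irrefl)
  then show ?thesis using P by simp
qed

text \<open>Adding \<open>P0\<close> to an odd \<open>Q\<close> makes it even, hence halvable up to
  2-torsion. This addition at most squares \<open>denom Q\<close>, while doubling raises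
  \<open>denom R\<close> to the fourth power; so \<open>denom R ^ 2\<close> is at most a constant
  times \<open>denom Q\<close>.\<close>

lemma odd_type_generates:
  assumes P0: "P0 \<in> carrier J" "\<not> even_type P0" and P: "P \<in> carrier J"
  shows "\<exists>(k::int) (m::int). k \<noteq> 0 \<and> P [^]\<^bsub>J\<^esub> k = P0 [^]\<^bsub>J\<^esub> m"
proof (rule J.descent_multiple[OF P0(1) P finite_denom_le])
  fix Q assume Q: "Q \<in> carrier J"
  define n :: int where "n = (if even_type Q then 0 else 1)"
  define X where "X = Q \<otimes>\<^bsub>J\<^esub> P0 [^]\<^bsub>J\<^esub> n"
  have X: "X \<in> carrier J" using Q P0 by (simp add: X_def)
  have "even_type X" using Q P0 even_type_add[of Q P0] by (auto simp: X_def n_def)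
  then obtain T R where T: "T \<in> carrier J" "fst T = 0" and R: "R \<in> carrier J" "R \<otimes>\<^bsub>J\<^esub> R = X \<otimes>\<^bsub>J\<^esub> T"
    using even_type_double_plus_sign[OF X] by blast
  have sq: "Y [^]\<^bsub>J\<^esub> (2::int) = Y \<otimes>\<^bsub>J\<^esub> Y" if "Y \<in> carrier J" for Y
    using J.int_pow_mult[OF that, of 1 1] that by simp
  have "R [^]\<^bsub>J\<^esub> (4::int) = (R [^]\<^bsub>J\<^esub> (2::int)) [^]\<^bsub>J\<^esub> (2::int)"
    using R by (simp add: J.int_pow_pow)
  also have "\<dots> = X [^]\<^bsub>J\<^esub> (2::int) \<otimes>\<^bsub>J\<^esub> T [^]\<^bsub>J\<^esub> (2::int)"
    using X T by (simp only: sq[OF R(1)] R(2) J.int_pow_distrib)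
  also have "\<dots> = Q [^]\<^bsub>J\<^esub> (2::int) \<otimes>\<^bsub>J\<^esub> P0 [^]\<^bsub>J\<^esub> (n * 2)"
    using X T Q P0 by (simp add: sq[of T] torsion_square X_def J.int_pow_distrib J.int_pow_pow)
  finally have 1: "R [^]\<^bsub>J\<^esub> (4::int) = Q [^]\<^bsub>J\<^esub> (2::int) \<otimes>\<^bsub>J\<^esub> P0 [^]\<^bsub>J\<^esub> (n * 2)" .
  have "denom X \<le> denom Q ^ 2 * denom P0 ^ 2"
  proof (cases "even_type Q")
    case True
    have "denom Q * 1 \<le> denom Q ^ 2 * denom P0 ^ 2"
      using denom_pos[of Q] denom_pos[of P0] by (intro mult_mono) (auto simp: power2_eq_square)
    then show ?thesis using True Q by (simp add: X_def n_def)
  next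
    case False
    then show ?thesis using denom_add_le[OF Q P0(1)] P0 by (simp add: X_def n_def)
  qed
  then have "denom (R \<otimes>\<^bsub>J\<^esub> R) \<le> denom Q ^ 2 * denom P0 ^ 2"
    using R denom_add_torsion_le[OF X T] by simp
  define K where "K = 8 * nat q ^ 2 * denom P0 ^ 2"
  have "denom R ^ 4 \<le> 8 * nat q ^ 2 * (denom Q ^ 2 * denom P0 ^ 2)"
    using denom_double_ge[OF R(1)] \<open>denom (R \<otimes>\<^bsub>J\<^esub> R) \<le> _\<close> by (meson le_trans mult_le_mono2)
  also have "\<dots> = K * denom Q ^ 2" by (simp add: K_def)
  \<comment> \<open>As \<open>K \<ge> 1\<close>, a second factor \<open>K\<close> may be inserted to
    obtain a perfect square.\<close>
  also have "\<dots> \<le> K * K * denom Q ^ 2"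
    using denom_pos[of P0] q_gt_4 by (simp add: K_def)
  finally have "(denom R ^ 2) ^ 2 \<le> (K * denom Q) ^ 2"
    by (simp add: power_mult_distrib power2_eq_square power4_eq_xxxx mult_ac)
  then have "denom R ^ 2 \<le> K * denom Q" by (rule power2_le_imp_le) simp
  then show "\<exists>z\<in>carrier J. \<exists>n::int. z [^]\<^bsub>J\<^esub> (4::int) = Q [^]\<^bsub>J\<^esub> (2::int) \<otimes>\<^bsub>J\<^esub> P0 [^]\<^bsub>J\<^esub> n
      \<and> denom z ^ 2 \<le> 8 * nat q ^ 2 * denom P0 ^ 2 * denom Q"
    using R(1) 1 by (auto simp: K_def)
qed

section \<open>Infinite order of odd points\<close>

text \<open>The numerator of the double is \<open>2 * s * c * d\<close>. Here \<open>c = 0\<close>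
  would give \<open>q + 4 * d^2 = 4\<close>, and \<open>d = 0\<close> would make \<open>q\<close> a
  square; so no rational point has order 4.\<close>

lemma fst_double_eq_0:
  assumes "P \<in> carrier J" "fst (P \<otimes>\<^bsub>J\<^esub> P) = 0"
  shows "fst P = 0"
proof -
  obtain s c d where P: "P = (s, c, d)" by (metis prod_cases3)
  have eqs: "4 * s^2 + c^2 = 1" "of_int q * s^2 + d^2 = 1"
    using assms by (auto simp: P jac_group_def jac_points_def)
  have "0 < 1 - 4 * of_int q * s * s * s * s"
    using denominator_pos assms(1) by (auto simp: P jac_group_def)
  then have "s * c * d = 0" using assms(2) by (auto simp: P jac_group_def Let_def)
  moreover have "c \<noteq> 0"
  proof
    assume "c = 0"
    then have "of_int q + 4 * d^2 = 4" using eqs by algebra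
    moreover have "4 < rat_of_int q" using q_gt_4 by simp
    ultimately show False using zero_le_power2[of d] by linarith
  qed
  moreover have "d \<noteq> 0"
  proof
    assume "d = 0"
    then have "of_int q * s^2 = 1" using eqs by simp
    then have "(1 / s)^2 = of_int q" by (cases "s = 0") (auto simp: field_simps)
    with q_nonsquare show False by blast
  qed
  ultimately show ?thesis by (simp add: P)
qed

text \<open>The hypothesis is \<open>s = 0\<close> and not the identity, because halving the
  identity only yields a 2-torsion point; in this form the induction closes. For odd
  \<open>k\<close>, \<open>P0\<close> would be a difference of even points.\<close>

lemma odd_type_infinite_order:
  assumes P0: "P0 \<in> carrier J" "\<not> even_type P0"
  shows "fst (P0 [^]\<^bsub>J\<^esub> k) = 0 \<Longrightarrow> k = (0::int)"
proof (induction "nat \<bar>k\<bar>" arbitrary: k rule: less_induct)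
  case less
  define j where "j = k div 2"
  define R where "R = P0 [^]\<^bsub>J\<^esub> j"
  have R: "R \<in> carrier J" using P0 by (simp add: R_def)
  have RR: "R \<otimes>\<^bsub>J\<^esub> R = P0 [^]\<^bsub>J\<^esub> (2 * j)"
    using P0 by (simp add: R_def J.int_pow_mult[symmetric])
  have "even_type (P0 [^]\<^bsub>J\<^esub> k)"
    using less.prems unfolding even_type_def by (intro exI[of _ 0] exI[of _ 1]) simp
  have "even k"
  proof (rule ccontr)
    assume "odd k"
    then have "P0 [^]\<^bsub>J\<^esub> k = R \<otimes>\<^bsub>J\<^esub> R \<otimes>\<^bsub>J\<^esub> P0"
      using P0 J.int_pow_mult[of P0 "2 * j" 1] by (simp add: RR j_def)
    then have "P0 = inv\<^bsub>J\<^esub> (R \<otimes>\<^bsub>J\<^esub> R) \<otimes>\<^bsub>J\<^esub> P0 [^]\<^bsub>J\<^esub> k"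
      using J.inv_solve_left[OF P0(1) J.m_closed[OF R R] J.int_pow_closed[OF P0(1)]] by blast
    moreover have "even_type (inv\<^bsub>J\<^esub> (R \<otimes>\<^bsub>J\<^esub> R))"
      using R by (intro even_type_inv even_type_add) auto
    ultimately show False
      using even_type_add[of "inv\<^bsub>J\<^esub> (R \<otimes>\<^bsub>J\<^esub> R)" "P0 [^]\<^bsub>J\<^esub> k"] \<open>even_type (P0 [^]\<^bsub>J\<^esub> k)\<close> P0 R by simp
  qed
  then have k: "k = 2 * j" by (simp add: j_def)
  then have "fst R = 0" using fst_double_eq_0[OF R] less.prems RR by simp
  then show ?case using less.hyps[of j] k by (cases "k = 0") (auto simp: R_def abs_mult)
qed

end

section \<open>The rank\<close>

theorem theorem4p1:
  fixes a :: int
  assumes "prime (a^2 - 2)" and "prime (a^2 + 2)"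
  shows "abelian_rank (E_group a) = 1"
proof -
  define p q where "p = a^2 - 2" and "q = a^2 + 2"
  have prime: "prime p" "prime q" using assms by (simp_all add: p_def q_def)
  \<comment> \<open>For even \<open>a\<close> the prime \<open>q\<close> would be at most 2 and
    \<open>p = q - 4\<close> negative.\<close>
  have "odd a"
  proof
    assume "even a"
    then have "even q" by (simp add: q_def)
    then have "q \<le> 2" using prime_odd_int[OF prime(2)] by force
    then show False using prime_gt_0_int[OF prime(1)] by (simp add: p_def q_def)
  qed
  then obtain b where b: "a = 2 * b + 1" by (metis oddE)
  \<comment> \<open>\<open>a^2 = 4 * b * (b + 1) + 1\<close> is 1 modulo 8, whence \<open>q\<close>
    is 3 modulo 8.\<close>
  have "even (b * (b + 1))" by simp
  then obtain k where "b * (b + 1) = 2 * k" by blast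
  then have "q = 8 * k + 3" unfolding q_def b by algebra
  then interpret twin_jacobi p q
    using prime by unfold_locales (simp_all add: p_def q_def)
  have qp: "rat_of_int q - of_int p = 4" by (simp add: p_def q_def)
  interpret E: split_curve "rat_of_int p" "of_int q"
  proof
    show "0 < rat_of_int p" "rat_of_int p < of_int q" using p_pos q_eq by simp_all
    show "r^2 \<noteq> of_int q" for r :: rat by (rule q_nonsquare)
    \<comment> \<open>\<open>q - p = 4\<close> is a square, so this reduces to \<open>q\<close> not
      being one.\<close>
    show "r^2 \<noteq> of_int q * (of_int q - of_int p)" for r :: rat
      using q_nonsquare[of "r / 2"] unfolding qp by (simp add: power_divide)
  qed
  have E: "E_group a = E.curve_group"
    by (simp add: E_group_def p_def q_def algebra_simps power4_eq_xxxx power2_eq_square)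
  define \<phi> where "\<phi> = ec_to_jac (rat_of_int p) (of_int q)"
  interpret EG: comm_group E.curve_group by (rule E.curve_comm_group)
  interpret \<phi>: group_hom E.curve_group J \<phi>
    using E.ec_to_jac_hom EG.is_group J.is_group
    by (simp add: \<phi>_def qp group_hom_def group_hom_axioms_def)
  have inj: "inj_on \<phi> (carrier E.curve_group)"
    using E.ec_to_jac_inj by (simp add: \<phi>_def ec_group_def)
  \<comment> \<open>At \<open>x = - (a^2)\<close> the factors \<open>x + p\<close> and
    \<open>x + q\<close> are \<open>-2\<close> and \<open>2\<close>, so
    \<open>y^2 = 4 * a^2\<close>.\<close>
  define P0 where "P0 = Affine (- (rat_of_int a^2)) (2 * of_int a)"
  have P0: "P0 \<in> carrier E.curve_group"
    by (simp add: P0_def ec_group_def ec_points_def p_def q_def) algebra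
  have "fst (\<phi> P0) = of_int (4 * a) / of_int (- 4 * (a^2 + 1))"
  proof -
    have "(- (rat_of_int a^2))^2 + 2 * of_int q * (- (of_int a^2)) + of_int p * of_int q
        = of_int (- 4 * (a^2 + 1))"
      by (simp add: p_def q_def) algebra
    then show ?thesis
      unfolding \<phi>_def P0_def ec_to_jac.simps Let_def by simp
  qed
  then have P0_s: "fst (\<phi> P0) * of_int (a^2 + 1) = - of_int a"
  proof -
    define t where "t = a^2 + 1"
    have "t \<noteq> 0" using zero_le_power2[of a] unfolding t_def by linarith
    with \<open>fst (\<phi> P0) = _\<close> show ?thesis unfolding t_def[symmetric] by simp
  qed
  \<comment> \<open>In \<open>s = - a / (a^2 + 1)\<close> the numerator is odd and the denominator
    even.\<close>
  have P0_odd: "\<not> even_type (\<phi> P0)"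
  proof
    assume "even_type (\<phi> P0)"
    then obtain A B :: int where AB: "even A" "odd B" "fst (\<phi> P0) = of_int A / of_int B"
      by (auto simp: even_type_def)
    then have "B \<noteq> 0" by auto
    then have "rat_of_int (A * (a^2 + 1)) = of_int (- a * B)"
      using P0_s AB(3) by (simp add: field_simps)
    then have "A * (a^2 + 1) = - a * B" by (simp only: of_int_eq_iff)
    then have "even (- a * B)" using AB(1) by (metis dvd_mult2)
    then show False using \<open>odd a\<close> AB(2) by simp
  qed
  have "abelian_rank E.curve_group = 1"
  proof (rule EG.abelian_rank_eq_1I[OF P0])
    fix k :: int assume "k \<noteq> 0"
    show "P0 [^]\<^bsub>E.curve_group\<^esub> k \<noteq> \<one>\<^bsub>E.curve_group\<^esub>"
    proof
      assume "P0 [^]\<^bsub>E.curve_group\<^esub> k = \<one>\<^bsub>E.curve_group\<^esub>"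
      then have "\<phi> P0 [^]\<^bsub>J\<^esub> k = \<one>\<^bsub>J\<^esub>" using P0 by (metis \<phi>.hom_int_pow \<phi>.hom_one)
      then show False
        using odd_type_infinite_order[OF \<phi>.hom_closed[OF P0] P0_odd, of k] \<open>k \<noteq> 0\<close>
        by (simp add: jac_group_def)
    qed
  next
    fix P assume P: "P \<in> carrier E.curve_group"
    obtain k m :: int where "k \<noteq> 0" "\<phi> P [^]\<^bsub>J\<^esub> k = \<phi> P0 [^]\<^bsub>J\<^esub> m"
      using odd_type_generates[OF \<phi>.hom_closed[OF P0] P0_odd \<phi>.hom_closed[OF P]] by blast
    \<comment> \<open>The relation between multiples on the quadrics is pulled back by injectivity
      of \<open>\<phi>\<close>.\<close>
    then have "\<phi> (P [^]\<^bsub>E.curve_group\<^esub> k) = \<phi> (P0 [^]\<^bsub>E.curve_group\<^esub> m)"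
      using P P0 by (simp add: \<phi>.hom_int_pow)
    then have "P [^]\<^bsub>E.curve_group\<^esub> k = P0 [^]\<^bsub>E.curve_group\<^esub> m"
      using inj P P0 by (simp add: inj_on_eq_iff)
    with \<open>k \<noteq> 0\<close> show "\<exists>(k::int) (m::int). k \<noteq> 0 \<and> P [^]\<^bsub>E.curve_group\<^esub> k = P0 [^]\<^bsub>E.curve_group\<^esub> m"
      by blast
  qed
  then show ?thesis by (simp add: E)
qed

end
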